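(* Let $X(t)$ be the random walk in random environment described in the context (with the standing structural assumptions there). Assume that $r_k\in L_2(\Omega,\pi)$ for all $k\in\mathcal N$ and $h_{k,l}\in L_1(\Omega,\pi)$ for all $k,l\in\mathcal N$. Then $$\lim_{t\to\infty}t^{-1}X(t)=0\qquad\text{a.s.}$$
   Context: Let $d\ge1$, let $(\Omega,\mathcal F,\pi,(\tau_z:z\in\mathbb Z^d))$ be a probability space with an ergodic measure-preserving $\mathbb Z^d$-action, and let $\mathcal N:=\{k\in\mathbb Z^d:|k|=1\}$. Jump rates: $p=(p_k)_{k\in\mathcal N}:\Omega\to[0,\infty)^{\mathcal N}$ is measurable and $\pi$-a.s. bistochastic: $\sum_{k\in\mathcal N}p_k(\omega)=\sum_{k\in\mathcal N}p_{-k}(\tau_k\omega)$. Write $p_k(x,\omega):=p_k(\tau_x\omega)$, $x\in\mathbb Z^d$. Given $\omega$, $t\mapsto X(t)\in\mathbb Z^d$ is the continuous-time Markovian nearest neighbour walk with $X(0)=0$ and jump rate $p_k(x,\omega)$ from $x$ to $x+k$. $\mathbf P_\omega$ denotes (quenched) probability for fixed $\omega$; $\mathbf P(\cdot):=\int_\Omega\mathbf P_\omega(\cdot)\,d\pi(\omega)$ is the annealed probability. "a.s." refers to $\mathbf P$. Symmetric and antisymmetric parts: $s_k(\omega):=\tfrac12(p_k(\omega)+p_{-k}(\tau_k\omega))$, $b_k(\omega):=\tfrac12(p_k(\omega)-p_{-k}(\tau_k\omega))$. Standing assumption (weak ellipticity): $0<s_k(\omega)<\infty$ $\pi$-a.s.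 for all $k\in\mathcal N$. Put $r_k:=\sqrt{s_k}$. Standing structural assumption (divergence form): there is a measurable $h=(h_{k,l}):\Omega\to\mathbb R^{\mathcal N\times\mathcal N}$ with, $\pi$-a.s. for all $k,l\in\mathcal N$, $h_{k,l}(\omega)=-h_{-k,l}(\tau_k\omega)=-h_{k,-l}(\tau_l\omega)=-h_{l,k}(\omega)$ and $b_k(\omega)=\sum_{l\in\mathcal N}h_{k,l}(\omega)$. *)

theory Defs
  imports "HOL-Probability.Probability"
begin

definition lattice_vec :: "int ^ 'd \<Rightarrow> real ^ 'd" where
  "lattice_vec x = (\<chi> i. real_of_int (x $ i))"

definition unit_steps :: "(int ^ 'd) set" where
  "unit_steps = {k. norm (lattice_vec k) = 1}"

lemma finite_unit_steps: "finite (unit_steps :: (int ^ 'd) set)"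
proof -
  have "\<bar>k $ i\<bar> \<le> 1" if "k \<in> unit_steps" for k :: "int ^ 'd" and i
    using component_le_norm_cart[of "lattice_vec k" i] that
    by (simp add: unit_steps_def lattice_vec_def)
  then have "vec_nth ` (unit_steps :: (int ^ 'd) set) \<subseteq> (\<Pi>\<^sub>E i\<in>UNIV. {-1..1})"
    by (force simp: abs_le_iff)
  then have "finite (vec_nth ` (unit_steps :: (int ^ 'd) set))"
    by (rule finite_subset) (simp add: finite_PiE)
  then show ?thesis
    by (rule finite_imageD) (simp add: inj_on_def vec_eq_iff)
qed

definition measure_preserving_action :: "'a measure \<Rightarrow> (int ^ 'd \<Rightarrow> 'a \<Rightarrow> 'a) \<Rightarrow> bool" where
  "measure_preserving_action M \<tau> \<longleftrightarrow>
     (\<forall>z. \<tau> z \<in> measurable M M \<and> distr M M (\<tau> z) = M) \<and>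
     (\<forall>\<omega>\<in>space M. \<tau> 0 \<omega> = \<omega>) \<and>
     (\<forall>x y. \<forall>\<omega>\<in>space M. \<tau> (x + y) \<omega> = \<tau> x (\<tau> y \<omega>))"

definition ergodic_action :: "'a measure \<Rightarrow> (int ^ 'd \<Rightarrow> 'a \<Rightarrow> 'a) \<Rightarrow> bool" where
  "ergodic_action M \<tau> \<longleftrightarrow>
     measure_preserving_action M \<tau> \<and>
     (\<forall>A\<in>sets M. (\<forall>z. \<tau> z -` A \<inter> space M = A) \<longrightarrow> measure M A = 0 \<or> measure M A = 1)"

text \<open>Below, \<open>p k \<omega>\<close> and \<open>h k l \<omega>\<close> are only meaningful for \<open>k\<close> and \<open>l\<close> in
  \<^const>\<open>unit_steps\<close>; their values at other indices are never constrained nor used.\<close>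

definition bistochastic :: "'a measure \<Rightarrow> (int ^ 'd \<Rightarrow> 'a \<Rightarrow> 'a) \<Rightarrow> (int ^ 'd \<Rightarrow> 'a \<Rightarrow> real) \<Rightarrow> bool" where
  "bistochastic M \<tau> p \<longleftrightarrow>
     (AE \<omega> in M. (\<Sum>k\<in>unit_steps. p k \<omega>) = (\<Sum>k\<in>unit_steps. p (- k) (\<tau> k \<omega>)))"

definition sym_part :: "(int ^ 'd \<Rightarrow> 'a \<Rightarrow> 'a) \<Rightarrow> (int ^ 'd \<Rightarrow> 'a \<Rightarrow> real) \<Rightarrow> int ^ 'd \<Rightarrow> 'a \<Rightarrow> real" where
  "sym_part \<tau> p k \<omega> = (p k \<omega> + p (- k) (\<tau> k \<omega>)) / 2"

definition antisym_part :: "(int ^ 'd \<Rightarrow> 'a \<Rightarrow> 'a) \<Rightarrow> (int ^ 'd \<Rightarrow> 'a \<Rightarrow> real) \<Rightarrow> int ^ 'd \<Rightarrow> 'a \<Rightarrow> real" where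
  "antisym_part \<tau> p k \<omega> = (p k \<omega> - p (- k) (\<tau> k \<omega>)) / 2"

definition weakly_elliptic :: "'a measure \<Rightarrow> (int ^ 'd \<Rightarrow> 'a \<Rightarrow> 'a) \<Rightarrow> (int ^ 'd \<Rightarrow> 'a \<Rightarrow> real) \<Rightarrow> bool" where
  "weakly_elliptic M \<tau> p \<longleftrightarrow> (AE \<omega> in M. \<forall>k\<in>unit_steps. 0 < sym_part \<tau> p k \<omega>)"

definition divergence_form ::
  "'a measure \<Rightarrow> (int ^ 'd \<Rightarrow> 'a \<Rightarrow> 'a) \<Rightarrow> (int ^ 'd \<Rightarrow> 'a \<Rightarrow> real) \<Rightarrow> (int ^ 'd \<Rightarrow> int ^ 'd \<Rightarrow> 'a \<Rightarrow> real) \<Rightarrow> bool"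
where
  "divergence_form M \<tau> p h \<longleftrightarrow>
     (\<forall>k\<in>unit_steps. \<forall>l\<in>unit_steps. h k l \<in> borel_measurable M) \<and>
     (AE \<omega> in M. \<forall>k\<in>unit_steps. \<forall>l\<in>unit_steps.
        h k l \<omega> = - h (- k) l (\<tau> k \<omega>) \<and>
        h k l \<omega> = - h k (- l) (\<tau> l \<omega>) \<and>
        h k l \<omega> = - h l k \<omega>) \<and>
     (AE \<omega> in M. \<forall>k\<in>unit_steps. antisym_part \<tau> p k \<omega> = (\<Sum>l\<in>unit_steps. h k l \<omega>))"

definition square_integrable :: "'a measure \<Rightarrow> ('a \<Rightarrow> real) \<Rightarrow> bool" where
  "square_integrable M f \<longleftrightarrow> f \<in> borel_measurable M \<and> integrable M (\<lambda>\<omega>. (f \<omega>)\<^sup>2)"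

text \<open>Nearest neighbour jump processes in continuous time; \<open>c x k\<close> is the rate of the jump
  from \<open>x\<close> to \<open>x + k\<close>. A site with total rate \<open>0\<close> is absorbing: the jump chain
  stays there and the holding time is infinite.\<close>

definition exit_rate :: "(int ^ 'd \<Rightarrow> int ^ 'd \<Rightarrow> real) \<Rightarrow> int ^ 'd \<Rightarrow> real" where
  "exit_rate c x = (\<Sum>k\<in>unit_steps. c x k)"

definition jump_prob :: "(int ^ 'd \<Rightarrow> int ^ 'd \<Rightarrow> real) \<Rightarrow> int ^ 'd \<Rightarrow> int ^ 'd \<Rightarrow> real" where
  "jump_prob c x y =
     (if exit_rate c x = 0 then of_bool (y = x)
      else if y - x \<in> unit_steps then c x (y - x) / exit_rate c x
      else 0)"

definition jump_time :: "(nat \<Rightarrow> 'w \<Rightarrow> ennreal) \<Rightarrow> nat \<Rightarrow> 'w \<Rightarrow> ennreal" where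
  "jump_time T n w = (\<Sum>i<n. T i w)"

text \<open>The continuous-time Markov chain \<open>X\<close> with jump rates \<open>c\<close>, started at \<open>x0\<close>, on the
  probability space \<open>N\<close>, given by its jump chain \<open>Y\<close> and holding times \<open>T\<close>: \<open>Y\<close> is a
  discrete-time Markov chain with transition matrix \<^term>\<open>jump_prob c\<close> and, conditionally on
  \<open>Y\<close>, the \<open>T i\<close> are independent and exponential with parameters \<^term>\<open>exit_rate c (Y i w)\<close>.
  The displayed probability of a cylinder event expresses exactly this.

  The process is pinned down only up to the explosion time, the supremum of the jump times. From
  then on \<open>X\<close> is arbitrary, so that an almost sure statement about \<open>X\<close> for large times
  cannot hold by virtue of a convention about what happens after explosion.\<close>

definition markov_jump_walk ::
  "'w measure \<Rightarrow> (int ^ 'd \<Rightarrow> int ^ 'd \<Rightarrow> real) \<Rightarrow> int ^ 'd \<Rightarrow>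
   (nat \<Rightarrow> 'w \<Rightarrow> int ^ 'd) \<Rightarrow> (nat \<Rightarrow> 'w \<Rightarrow> ennreal) \<Rightarrow> (real \<Rightarrow> 'w \<Rightarrow> int ^ 'd) \<Rightarrow> bool"
where
  "markov_jump_walk N c x0 Y T X \<longleftrightarrow>
     prob_space N \<and>
     (\<forall>n. Y n \<in> measurable N (count_space UNIV)) \<and>
     (\<forall>n. T n \<in> borel_measurable N) \<and>
     (\<forall>n (y :: nat \<Rightarrow> int ^ 'd) (t :: nat \<Rightarrow> real). (\<forall>i\<le>n. 0 \<le> t i) \<longrightarrow>
        measure N {w \<in> space N. \<forall>i\<le>n. Y i w = y i \<and> ennreal (t i) < T i w} =
          of_bool (y 0 = x0) *
          (\<Prod>i<n. jump_prob c (y i) (y (Suc i))) *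
          (\<Prod>i\<le>n. exp (- (exit_rate c (y i) * t i)))) \<and>
     (\<forall>w\<in>space N. \<forall>n t. 0 \<le> t \<and> jump_time T n w \<le> ennreal t \<and> ennreal t < jump_time T (Suc n) w
        \<longrightarrow> X t w = Y n w)"

definition environment_rates ::
  "(int ^ 'd \<Rightarrow> 'a \<Rightarrow> 'a) \<Rightarrow> (int ^ 'd \<Rightarrow> 'a \<Rightarrow> real) \<Rightarrow> 'a \<Rightarrow> int ^ 'd \<Rightarrow> int ^ 'd \<Rightarrow> real" where
  "environment_rates \<tau> p \<omega> x k = p k (\<tau> x \<omega>)"

text \<open>The annealed law \<open>A \<mapsto> \<integral> P \<omega> A dM(\<omega>)\<close> of a quenched kernel \<open>P\<close> is the Giry bind.\<close>

abbreviation annealed :: "'a measure \<Rightarrow> ('a \<Rightarrow> 'w measure) \<Rightarrow> 'w measure" where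
  "annealed M P \<equiv> M \<bind> P"

end

theory Submission
  imports Defs
begin

text \<open>
  By bistochasticity the environment seen from the jump chain has an invariant measure, with
  density the total exit rate with respect to \<open>\<pi>\<close>; it is finite since \<open>r k\<close> is in
  \<open>L\<^sub>2\<close>. If a bounded function \<open>G\<close> of a jump and of its holding time has negative mean
  under the stationary law, then almost surely its partial sums are bounded above: the probability
  that they are not is a bounded harmonic function of the environment, hence constant, and the
  maximal ergodic inequality forces this constant to be 0. For \<open>G\<close> a signed coordinate of the
  jump minus \<open>\<epsilon>\<close> this shows that the jump chain has zero speed, as the mean drift
  vanishes by the divergence form. For \<open>G\<close> a small constant minus the indicator of a holding
  time above 1 it shows that the jump times grow at least linearly.
\<close>

section \<open>The maximal ergodic inequality\<close>

text \<open>Working with one invariant event at a time avoids a proof that the process of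
  environments is ergodic. One-sided bounds suffice: every \<epsilon> leaves room for a strictly
  negative mean, and both signs of each coordinate are treated. Since the rates may vanish in one
  direction of an edge, constancy of a harmonic function is drawn from the Dirichlet form, which
  after a translation weighs each edge by its symmetrised rate, positive by weak ellipticity even
  where the edge can be crossed only one way. Holding times may be unbounded; reduced to the flag
  "above 1" they fit the same theorem for bounded functions, and a positive frequency of flags
  bounds the jump times below by a linear function. This also excludes explosion, which has to be
  proved because \<open>X\<close> is arbitrary afterwards. The environment is integrated out in the
  stationary law: the functions and events concerned depend only on jumps and flags, while the
  environment survives as the parameter of the quenched law, whose dependence on it carries the
  harmonic function.\<close>

lemma maximal_ergodic_inequality:
  fixes g :: "'z \<Rightarrow> real"
  assumes "finite_measure Q" and th[measurable]: "\<theta> \<in> measurable Q Q" and inv: "distr Q Q \<theta> = Q"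
    and g[measurable]: "g \<in> borel_measurable Q" and gB: "\<And>z. \<bar>g z\<bar> \<le> B"
    and A[measurable]: "A \<in> sets Q" and Ainv: "\<And>z. z \<in> space Q \<Longrightarrow> \<theta> z \<in> A \<longleftrightarrow> z \<in> A"
    and pos: "\<And>z. z \<in> A \<Longrightarrow> \<exists>n. (\<Sum>i<n. g ((\<theta> ^^ i) z)) > 0"
  shows "0 \<le> (\<integral>z. indicator A z * g z \<partial>Q)"
proof -
  interpret finite_measure Q by fact
  \<comment> \<open>As in Garsia's proof: \<open>m n z\<close> is the largest of the partial sums of
    \<open>g\<close> along the orbit of \<open>z\<close> with at most \<open>n\<close> terms, the
    empty sum 0 included.\<close>
  define m where "m = rec_nat (\<lambda>_. 0) (\<lambda>_ f z. max 0 (g z + f (\<theta> z)))"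
  have m0: "m 0 z = 0" and mS: "m (Suc n) z = max 0 (g z + m n (\<theta> z))" for n z
    by (simp_all add: m_def)
  have [measurable]: "m n \<in> borel_measurable Q" for n
  proof (induction n)
    case 0 show ?case by (simp add: m_def)
  next
    case (Suc n)
    note Suc[measurable]
    have "m (Suc n) = (\<lambda>z. max 0 (g z + m n (\<theta> z)))" by (simp add: fun_eq_iff mS)
    then show ?case by simp
  qed
  have nonneg: "0 \<le> m n z" for n z by (cases n) (auto simp: m0 mS)
  have mono: "m n z \<le> m (Suc n) z" for n z
  proof (induction n arbitrary: z)
    case 0 then show ?case by (simp add: m0 mS)
  next
    case (Suc n)
    show ?case using Suc[of "\<theta> z"] unfolding mS[of "Suc n" z] mS[of n z] by linarith
  qed
  have B0: "0 \<le> B" using gB[of undefined] by linarith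
  have bound: "m n z \<le> n * B" for n z
  proof (induction n arbitrary: z)
    case 0 then show ?case by (simp add: m0)
  next
    case (Suc n)
    have "g z \<le> B" using gB[of z] by linarith
    moreover have "m n (\<theta> z) \<le> n * B" by (rule Suc)
    moreover have "0 \<le> n * B" using B0 by simp
    ultimately show ?case using B0 by (simp add: mS algebra_simps)
  qed
  have partial: "(\<Sum>i<n. g ((\<theta> ^^ i) z)) \<le> m n z" for n z
  proof (induction n arbitrary: z)
    case 0 then show ?case by (simp add: m0)
  next
    case (Suc n)
    have "(\<Sum>i<Suc n. g ((\<theta> ^^ i) z)) = g z + (\<Sum>i<n. g ((\<theta> ^^ i) (\<theta> z)))"
      by (subst sum.lessThan_Suc_shift) (simp add: funpow_swap1)
    also have "\<dots> \<le> g z + m n (\<theta> z)" using Suc[of "\<theta> z"] by simp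
    finally show ?case by (simp add: mS)
  qed
  have intm: "integrable Q (\<lambda>z. indicator A z * m n z)" for n
  proof (rule integrable_const_bound[where B="n * B"])
    show "AE z in Q. norm (indicator A z * m n z) \<le> n * B"
    proof (rule AE_I2)
      fix z show "norm (indicator A z * m n z) \<le> n * B"
        using bound[of n z] nonneg[of n z] B0 by (cases "z \<in> A") auto
    qed
  qed simp
  define E where "E n = {z \<in> space Q. 0 < m n z}" for n
  have [measurable]: "E n \<in> sets Q" for n unfolding E_def by measurable
  have intg: "integrable Q (\<lambda>z. indicator A z * (indicator (E n) z * g z))" for n
    by (rule integrable_const_bound[where B=B])
       (auto simp: B0 gB indicator_def split: if_splits)
  have key: "0 \<le> (\<integral>z. indicator A z * (indicator (E n) z * g z) \<partial>Q)" for n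
  proof (cases n)
    case 0 then show ?thesis by (simp add: E_def m0)
  next
    case (Suc j)
    have intS: "integrable Q (\<lambda>z. indicator A (\<theta> z) * m n (\<theta> z))"
      using integrable_distr[of \<theta> Q Q "\<lambda>z. indicator A z * m n z"] intm[of n] inv by simp
    have "(\<integral>z. indicator A (\<theta> z) * m n (\<theta> z) \<partial>Q) = (\<integral>z. indicator A z * m n z \<partial>distr Q Q \<theta>)"
      by (rule integral_distr[symmetric]) auto
    then have "0 = (\<integral>z. indicator A z * m n z - indicator A (\<theta> z) * m n (\<theta> z) \<partial>Q)"
      using intS intm[of n] inv by simp
    also have "\<dots> \<le> (\<integral>z. indicator A z * (indicator (E n) z * g z) \<partial>Q)"
    proof (rule integral_mono)
      show "integrable Q (\<lambda>z. indicator A z * m n z - indicator A (\<theta> z) * m n (\<theta> z))"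
        using intS intm[of n] by simp
      show "integrable Q (\<lambda>z. indicator A z * (indicator (E n) z * g z))" by (rule intg)
      fix z assume z: "z \<in> space Q"
      \<comment> \<open>Where \<open>m n z\<close> is positive it equals
        \<open>g z + m j (\<theta> z)\<close>, and \<open>m j\<close> is at most \<open>m n\<close>;
        elsewhere \<open>m n z\<close> is 0 and \<open>m n (\<theta> z)\<close> is nonnegative. By
        invariance the left side has integral 0 over \<open>A\<close>.\<close>
      have "m n z - m n (\<theta> z) \<le> indicator (E n) z * g z"
        using z mono[of j "\<theta> z"] nonneg[of n "\<theta> z"] unfolding Suc
        by (auto simp: E_def indicator_def mS max_def split: if_splits)
      then show "indicator A z * m n z - indicator A (\<theta> z) * m n (\<theta> z)
          \<le> indicator A z * (indicator (E n) z * g z)"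
        using Ainv[OF z] by (auto simp: indicator_def)
    qed
    finally show ?thesis .
  qed
  \<comment> \<open>By \<open>pos\<close> the increasing sets \<open>E n\<close> exhaust
    \<open>A\<close>, so the restriction to \<open>E n\<close> disappears in the limit.\<close>
  have "(\<lambda>n. \<integral>z. indicator A z * (indicator (E n) z * g z) \<partial>Q) \<longlonglongrightarrow> (\<integral>z. indicator A z * g z \<partial>Q)"
  proof (rule integral_dominated_convergence[where w="\<lambda>_. B"])
    show "AE z in Q. (\<lambda>n. indicator A z * (indicator (E n) z * g z)) \<longlonglongrightarrow> indicator A z * g z"
    proof (rule AE_I2, rule tendsto_eventually)
      fix z assume z: "z \<in> space Q"
      show "\<forall>\<^sub>F n in sequentially. indicator A z * (indicator (E n) z * g z) = indicator A z * g z"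
      proof (cases "z \<in> A")
        case True
        then obtain N where "0 < m N z" using pos partial by (meson less_le_trans)
        moreover have "m N z \<le> m n z" if "N \<le> n" for n
          using lift_Suc_mono_le[of "\<lambda>n. m n z", OF mono that] .
        ultimately have "z \<in> E n" if "N \<le> n" for n
          using that z by (fastforce simp: E_def)
        then show ?thesis by (intro eventually_sequentiallyI[of N]) simp
      qed simp
    qed
    show "AE z in Q. norm (indicator A z * (indicator (E n) z * g z)) \<le> B" for n
      by (auto simp: B0 gB indicator_def split: if_splits)
  qed auto
  then show ?thesis by (rule LIMSEQ_le_const) (use key in blast)
qed

section \<open>The environment\<close>

lemma unit_steps_uminus_iff [simp]: "- k \<in> unit_steps \<longleftrightarrow> k \<in> unit_steps"
proof -
  have "lattice_vec (- k) = - lattice_vec k" by (simp add: lattice_vec_def vec_eq_iff)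
  then show ?thesis by (simp add: unit_steps_def)
qed

lemma sum_unit_steps_uminus: "(\<Sum>k\<in>unit_steps. f (- k)) = (\<Sum>k\<in>unit_steps. f k)"
  by (rule sum.reindex_bij_witness[of _ uminus uminus]) auto

lemma zero_notin_unit_steps [simp]: "(0 :: int ^ 'd) \<notin> unit_steps"
proof -
  have "lattice_vec (0 :: int ^ 'd) = 0" by (simp add: lattice_vec_def vec_eq_iff)
  then show ?thesis by (simp add: unit_steps_def)
qed

lemma axis_in_unit_steps: "\<bar>s\<bar> = 1 \<Longrightarrow> axis i s \<in> unit_steps"
proof -
  assume s: "\<bar>s\<bar> = 1"
  have "lattice_vec (axis i s) = real_of_int s *\<^sub>R axis i 1"
    by (simp add: lattice_vec_def axis_def vec_eq_iff)
  moreover have "\<bar>real_of_int s\<bar> = 1" using s by linarith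
  ultimately show ?thesis by (simp add: unit_steps_def norm_axis_1)
qed

lemma unit_steps_component_le: "k \<in> unit_steps \<Longrightarrow> \<bar>real_of_int (k $ i)\<bar> \<le> 1"
  using component_le_norm_cart[of "lattice_vec k" i] by (simp add: unit_steps_def lattice_vec_def)

text \<open>Lets invariance under nearest neighbour shifts pass to the whole group, which is what
  ergodicity speaks about.\<close>

lemma unit_steps_generate:
  fixes z :: "int ^ 'd"
  assumes unit: "\<And>k. k \<in> unit_steps \<Longrightarrow> P k" and zero: "P 0"
    and add: "\<And>x y. P x \<Longrightarrow> P y \<Longrightarrow> P (x + y)"
  shows "P z"
proof -
  have ax: "P (axis i (int n))" "P (axis i (- int n))" for i n
  proof (induction n)
    case 0
    have eq: "axis i 0 = (0 :: int ^ 'd)" for i by (simp add: axis_def vec_eq_iff)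
    then show "P (axis i (int 0))" "P (axis i (- int 0))" using zero by (simp_all only: eq of_nat_0 minus_zero)
  next
    case (Suc n)
    have "axis i (int (Suc n)) = axis i 1 + (axis i (int n) :: int ^ 'd)"
      "axis i (- int (Suc n)) = axis i (- 1) + (axis i (- int n) :: int ^ 'd)"
      by (simp_all add: axis_def vec_eq_iff)
    then show "P (axis i (int (Suc n)))" "P (axis i (- int (Suc n)))"
      using Suc add unit axis_in_unit_steps[of 1 i] axis_in_unit_steps[of "- 1" i] by simp_all
  qed
  have axz: "P (axis i a)" for i a
    using ax[of i "nat \<bar>a\<bar>"] by (cases "0 \<le> a") auto
  have sums: "P (\<Sum>i\<in>I. axis i (z $ i))" for I :: "'d set"
    by (induction I rule: infinite_finite_induct) (auto intro: add axz simp: zero)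
  have "(\<Sum>i\<in>UNIV. axis i (z $ i)) = z"
    by (simp add: vec_eq_iff axis_def sum.delta)
  then show ?thesis using sums[of UNIV] by simp
qed

definition total_rate :: "(int ^ 'd \<Rightarrow> 'a \<Rightarrow> real) \<Rightarrow> 'a \<Rightarrow> real" where
  "total_rate p \<omega> = (\<Sum>k\<in>unit_steps. p k \<omega>)"

text \<open>Integrability of \<open>p k\<close> is the form in which square integrability of
  \<open>r k\<close> enters, since \<open>p k\<close> is at most twice the symmetric part. The
  divergence form is brought in separately, through the mean rates.\<close>

locale random_environment = prob_space M
  for M :: "'a measure" and \<tau> :: "int ^ 'd \<Rightarrow> 'a \<Rightarrow> 'a" and p :: "int ^ 'd \<Rightarrow> 'a \<Rightarrow> real" +
  assumes ergodic: "ergodic_action M \<tau>"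
    and p_nonneg: "\<And>k \<omega>. k \<in> unit_steps \<Longrightarrow> \<omega> \<in> space M \<Longrightarrow> 0 \<le> p k \<omega>"
    and p_integrable [simp, intro]: "\<And>k. k \<in> unit_steps \<Longrightarrow> integrable M (p k)"
    and bistochastic: "bistochastic M \<tau> p"
    and weakly_elliptic: "weakly_elliptic M \<tau> p"
begin

lemma p_measurable [measurable]: "k \<in> unit_steps \<Longrightarrow> p k \<in> borel_measurable M"
  using p_integrable by blast

lemma shift_measurable [measurable]: "\<tau> z \<in> measurable M M"
  and shift_distr: "distr M M (\<tau> z) = M"
  and shift_zero: "\<omega> \<in> space M \<Longrightarrow> \<tau> 0 \<omega> = \<omega>"
  and shift_add: "\<omega> \<in> space M \<Longrightarrow> \<tau> (x + y) \<omega> = \<tau> x (\<tau> y \<omega>)"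
  using ergodic by (auto simp: ergodic_action_def measure_preserving_action_def)

lemma shift_space [simp]: "\<omega> \<in> space M \<Longrightarrow> \<tau> z \<omega> \<in> space M"
  by (rule measurable_space[OF shift_measurable])

lemma shift_uminus [simp]: "\<omega> \<in> space M \<Longrightarrow> \<tau> k (\<tau> (- k) \<omega>) = \<omega>"
  "\<omega> \<in> space M \<Longrightarrow> \<tau> (- k) (\<tau> k \<omega>) = \<omega>"
  by (simp_all add: shift_add[symmetric] shift_zero)

lemma AE_shift: "AE \<omega> in M. R \<omega> \<Longrightarrow> AE \<omega> in M. R (\<tau> z \<omega>)"
  by (rule AE_distrD[OF shift_measurable]) (simp only: shift_distr)

lemma integrable_shift: "integrable M f \<Longrightarrow> integrable M (\<lambda>\<omega>. f (\<tau> z \<omega>) :: real)"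
  using integrable_distr[OF shift_measurable, of z f] by (simp add: shift_distr)

lemma integral_shift: "integrable M f \<Longrightarrow> (\<integral>\<omega>. f (\<tau> z \<omega>) \<partial>M) = (\<integral>\<omega>. f \<omega> \<partial>M :: real)"
  using integral_distr[OF shift_measurable[of z] borel_measurable_integrable, of f] by (simp add: shift_distr)

lemma integrable_p_times:
  assumes "k \<in> unit_steps" "f \<in> borel_measurable M" "\<And>\<omega>. \<omega> \<in> space M \<Longrightarrow> \<bar>f \<omega>\<bar> \<le> (B :: real)"
  shows "integrable M (\<lambda>\<omega>. p k \<omega> * f \<omega>)"
proof (rule Bochner_Integration.integrable_bound[where f="\<lambda>\<omega>. B * p k \<omega>"])
  show "AE \<omega> in M. norm (p k \<omega> * f \<omega>) \<le> norm (B * p k \<omega>)"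
  proof (rule AE_I2)
    fix \<omega> assume \<omega>: "\<omega> \<in> space M"
    have "0 \<le> B" using assms(3)[OF \<omega>] by linarith
    then show "norm (p k \<omega> * f \<omega>) \<le> norm (B * p k \<omega>)"
      using mult_left_mono[OF assms(3)[OF \<omega>], of "\<bar>p k \<omega>\<bar>"] by (simp add: abs_mult mult.commute)
  qed
qed (use assms in \<open>auto intro!: borel_measurable_times\<close>)

lemma total_rate_integrable [simp, intro]: "integrable M (total_rate p)"
  unfolding total_rate_def[abs_def] by (intro Bochner_Integration.integrable_sum) auto

lemma total_rate_measurable [measurable]: "total_rate p \<in> borel_measurable M"
  by (rule borel_measurable_integrable) simp

lemma total_rate_nonneg: "\<omega> \<in> space M \<Longrightarrow> 0 \<le> total_rate p \<omega>"
  unfolding total_rate_def by (intro sum_nonneg p_nonneg)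

text \<open>By weak ellipticity some edge at the origin can be crossed one way or the other, and by
  bistochasticity the rates in and out have equal sums, so together they make up twice the total
  rate.\<close>

lemma AE_total_rate_pos: "AE \<omega> in M. 0 < total_rate p \<omega>"
proof -
  let ?k = "axis undefined 1 :: int ^ 'd"
  have k: "?k \<in> unit_steps" by (rule axis_in_unit_steps) simp
  show ?thesis
    using weakly_elliptic[unfolded weakly_elliptic_def] bistochastic[unfolded bistochastic_def] AE_space
  proof eventually_elim
    case (elim \<omega>)
    have "0 < p ?k \<omega> + p (- ?k) (\<tau> ?k \<omega>)" using elim(1) k by (force simp: sym_part_def)
    also have "\<dots> \<le> total_rate p \<omega> + (\<Sum>k\<in>unit_steps. p (- k) (\<tau> k \<omega>))"
      unfolding total_rate_def using k elim(3)
      by (intro add_mono member_le_sum) (auto simp: finite_unit_steps p_nonneg)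
    also have "\<dots> = 2 * total_rate p \<omega>" using elim(2) by (simp add: total_rate_def)
    finally show ?case by simp
  qed
qed

text \<open>Bistochasticity says that \<open>total_rate p\<close> is the density of an invariant measure of the
  environment seen from the jump chain.\<close>

lemma integral_flux:
  assumes f [measurable]: "f \<in> borel_measurable M" and fB: "\<And>\<omega>. \<omega> \<in> space M \<Longrightarrow> \<bar>f \<omega>\<bar> \<le> (B :: real)"
  shows "(\<integral>\<omega>. (\<Sum>k\<in>unit_steps. p k \<omega> * f (\<tau> k \<omega>)) \<partial>M) = (\<integral>\<omega>. total_rate p \<omega> * f \<omega> \<partial>M)"
proof -
  have int: "integrable M (\<lambda>\<omega>. p k \<omega> * f (\<tau> k \<omega>))" if "k \<in> unit_steps" for k
    by (rule integrable_p_times[OF that _ fB]) simp_all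
  have eq: "p k (\<tau> (- k) \<omega>) * f (\<tau> k (\<tau> (- k) \<omega>)) = p k (\<tau> (- k) \<omega>) * f \<omega>" if "\<omega> \<in> space M" for k \<omega>
    using that by simp
  have int': "integrable M (\<lambda>\<omega>. p k (\<tau> (- k) \<omega>) * f \<omega>)" if "k \<in> unit_steps" for k
    using integrable_shift[OF int[OF that], of "- k"]
    by (subst (asm) Bochner_Integration.integrable_cong[OF refl eq]) auto
  have "(\<integral>\<omega>. (\<Sum>k\<in>unit_steps. p k \<omega> * f (\<tau> k \<omega>)) \<partial>M)
      = (\<Sum>k\<in>unit_steps. \<integral>\<omega>. p k \<omega> * f (\<tau> k \<omega>) \<partial>M)"
    using int by simp
  \<comment> \<open>Translating by \<open>- k\<close> puts the endpoint of the jump at the origin: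
    \<open>p k (\<tau> (- k) \<omega>)\<close> is the rate of a jump into the origin, and
    bistochasticity sums these rates to \<open>total_rate p \<omega>\<close>.\<close>
  also have "\<dots> = (\<Sum>k\<in>unit_steps. \<integral>\<omega>. p k (\<tau> (- k) \<omega>) * f \<omega> \<partial>M)"
  proof (rule sum.cong[OF refl])
    fix k :: "int ^ 'd" assume k: "k \<in> unit_steps"
    have "(\<integral>\<omega>. p k \<omega> * f (\<tau> k \<omega>) \<partial>M) = (\<integral>\<omega>. p k (\<tau> (- k) \<omega>) * f (\<tau> k (\<tau> (- k) \<omega>)) \<partial>M)"
      using integral_shift[OF int[OF k], of "- k"] by simp
    also have "\<dots> = (\<integral>\<omega>. p k (\<tau> (- k) \<omega>) * f \<omega> \<partial>M)"
      by (rule Bochner_Integration.integral_cong[OF refl eq])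
    finally show "(\<integral>\<omega>. p k \<omega> * f (\<tau> k \<omega>) \<partial>M) = (\<integral>\<omega>. p k (\<tau> (- k) \<omega>) * f \<omega> \<partial>M)" .
  qed
  also have "\<dots> = (\<integral>\<omega>. (\<Sum>k\<in>unit_steps. p k (\<tau> (- k) \<omega>) * f \<omega>) \<partial>M)"
    using int' by simp
  also have "\<dots> = (\<integral>\<omega>. total_rate p \<omega> * f \<omega> \<partial>M)"
  proof (rule integral_cong_AE)
    show "AE \<omega> in M. (\<Sum>k\<in>unit_steps. p k (\<tau> (- k) \<omega>) * f \<omega>) = total_rate p \<omega> * f \<omega>"
      using bistochastic[unfolded bistochastic_def]
    proof eventually_elim
      case (elim \<omega>)
      have "(\<Sum>k\<in>unit_steps. p k (\<tau> (- k) \<omega>)) = (\<Sum>k\<in>unit_steps. p (- k) (\<tau> k \<omega>))"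
        using sum_unit_steps_uminus[of "\<lambda>k. p k (\<tau> (- k) \<omega>)"] by simp
      then show ?case using elim by (simp add: total_rate_def sum_distrib_right[symmetric])
    qed
  qed (auto intro!: borel_measurable_sum)
  finally show ?thesis .
qed

text \<open>By ergodicity \<open>u\<close> lies almost surely on one side of its mean
  \<open>c\<close>, which forces equality.\<close>

lemma shift_invariant_AE_const:
  assumes u [measurable]: "u \<in> borel_measurable M" and uB: "\<And>\<omega>. \<omega> \<in> space M \<Longrightarrow> \<bar>u \<omega>\<bar> \<le> (B :: real)"
    and inv: "\<And>k. k \<in> unit_steps \<Longrightarrow> AE \<omega> in M. u (\<tau> k \<omega>) = u \<omega>"
  obtains c where "AE \<omega> in M. u \<omega> = c"
proof -
  have "AE \<omega> in M. u (\<tau> z \<omega>) = u \<omega>" for z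
  proof (rule unit_steps_generate[of "\<lambda>z. AE \<omega> in M. u (\<tau> z \<omega>) = u \<omega>"])
    show "AE \<omega> in M. u (\<tau> 0 \<omega>) = u \<omega>" by (rule AE_I2) (simp add: shift_zero)
    fix x y assume "AE \<omega> in M. u (\<tau> x \<omega>) = u \<omega>" and y: "AE \<omega> in M. u (\<tau> y \<omega>) = u \<omega>"
    then have "AE \<omega> in M. u (\<tau> x (\<tau> y \<omega>)) = u (\<tau> y \<omega>)" by (intro AE_shift)
    with y AE_space show "AE \<omega> in M. u (\<tau> (x + y) \<omega>) = u \<omega>"
      by eventually_elim (simp add: shift_add)
  qed (rule inv)
  then have all: "AE \<omega> in M. \<forall>z. u (\<tau> z \<omega>) = u \<omega>" by (simp add: AE_all_countable)
  have int: "integrable M u" using uB by (intro integrable_const_bound[where B=B]) auto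
  define c where "c = (\<integral>\<omega>. u \<omega> \<partial>M)"
  \<comment> \<open>The quantifier over all shifts makes \<open>A\<close> exactly invariant, as
    \<open>ergodic_action\<close> demands; the event \<open>u \<omega> \<le> c\<close> alone is
    invariant only up to a null set.\<close>
  define A where "A = {\<omega> \<in> space M. \<forall>z. u (\<tau> z \<omega>) \<le> c}"
  have A [measurable]: "A \<in> sets M" unfolding A_def by measurable
  have "\<tau> w -` A \<inter> space M = A" for w
  proof -
    have "(\<forall>z. u (\<tau> z (\<tau> w \<omega>)) \<le> c) \<longleftrightarrow> (\<forall>z. u (\<tau> z \<omega>) \<le> c)" if "\<omega> \<in> space M" for \<omega>
      using that by (metis shift_add diff_add_cancel)
    then show ?thesis by (auto simp: A_def)
  qed
  then consider "prob A = 1" | "prob A = 0" using ergodic A unfolding ergodic_action_def by blast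
  then have "AE \<omega> in M. u \<omega> = c"
  proof cases
    case 1
    then have "AE \<omega> in M. \<omega> \<in> A" by (simp add: prob_eq_1)
    then have le: "AE \<omega> in M. 0 \<le> c - u \<omega>" using all
      by eventually_elim (auto simp: A_def)
    have "(\<integral>\<omega>. c - u \<omega> \<partial>M) = 0" using int by (simp add: c_def prob_space)
    then have "AE \<omega> in M. c - u \<omega> = 0" using int le
      by (subst (asm) integral_nonneg_eq_0_iff_AE) auto
    then show ?thesis by eventually_elim simp
  next
    case 2
    then have "AE \<omega> in M. \<omega> \<notin> A" by (simp add: prob_eq_0)
    then have gt: "AE \<omega> in M. 0 < u \<omega> - c" using all AE_space
      by eventually_elim (auto simp: A_def)
    then have ge: "AE \<omega> in M. 0 \<le> u \<omega> - c" by eventually_elim simp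
    have "(\<integral>\<omega>. u \<omega> - c \<partial>M) = 0" using int by (simp add: c_def prob_space)
    then have "AE \<omega> in M. u \<omega> - c = 0" using int ge
      by (subst (asm) integral_nonneg_eq_0_iff_AE) auto
    then show ?thesis by eventually_elim simp
  qed
  then show ?thesis by (rule that)
qed

text \<open>By invariance the Dirichlet form of a harmonic \<open>u\<close> vanishes, and weak ellipticity
  makes every edge usable in at least one direction.\<close>

lemma harmonic_AE_const:
  assumes u [measurable]: "u \<in> borel_measurable M" and uB: "\<And>\<omega>. \<omega> \<in> space M \<Longrightarrow> \<bar>u \<omega>\<bar> \<le> (B :: real)"
    and harm: "AE \<omega> in M. total_rate p \<omega> * u \<omega> = (\<Sum>k\<in>unit_steps. p k \<omega> * u (\<tau> k \<omega>))"
  obtains c where "AE \<omega> in M. u \<omega> = c"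
proof -
  have u2B: "\<bar>(u \<omega>)\<^sup>2\<bar> \<le> B\<^sup>2" if "\<omega> \<in> space M" for \<omega>
    using abs_le_square_iff[of "u \<omega>" B] uB[OF that] by simp
  have dB: "\<bar>(u (\<tau> k \<omega>) - u \<omega>)\<^sup>2\<bar> \<le> (2 * B)\<^sup>2" if "\<omega> \<in> space M" for k \<omega>
  proof -
    have "\<bar>u (\<tau> k \<omega>) - u \<omega>\<bar> \<le> \<bar>2 * B\<bar>" 
      using uB[OF that] uB[OF shift_space[OF that], of k] by linarith
    then show ?thesis unfolding abs_le_square_iff by simp
  qed
  let ?D = "\<lambda>\<omega>. \<Sum>k\<in>unit_steps. p k \<omega> * (u (\<tau> k \<omega>) - u \<omega>)\<^sup>2"
  have intk: "integrable M (\<lambda>\<omega>. p k \<omega> * (u (\<tau> k \<omega>) - u \<omega>)\<^sup>2)" if "k \<in> unit_steps" for k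
    by (rule integrable_p_times[OF that _ dB]) simp_all
  have int2k: "integrable M (\<lambda>\<omega>. p k \<omega> * (u (\<tau> k \<omega>))\<^sup>2)" if "k \<in> unit_steps" for k
    by (rule integrable_p_times[OF that _ u2B]) simp_all
  have int2: "integrable M (\<lambda>\<omega>. total_rate p \<omega> * (u \<omega>)\<^sup>2)"
    unfolding total_rate_def sum_distrib_right
    by (intro Bochner_Integration.integrable_sum integrable_p_times[OF _ _ u2B]) auto
  have "(\<integral>\<omega>. ?D \<omega> \<partial>M) = (\<integral>\<omega>. (\<Sum>k\<in>unit_steps. p k \<omega> * (u (\<tau> k \<omega>))\<^sup>2) - total_rate p \<omega> * (u \<omega>)\<^sup>2 \<partial>M)"
  proof (rule integral_cong_AE)
    show "AE \<omega> in M. ?D \<omega> = (\<Sum>k\<in>unit_steps. p k \<omega> * (u (\<tau> k \<omega>))\<^sup>2) - total_rate p \<omega> * (u \<omega>)\<^sup>2"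
      using harm
    proof eventually_elim
      case (elim \<omega>)
      \<comment> \<open>Harmonicity turns the cross term into
        \<open>- 2 * total_rate p \<omega> * (u \<omega>)\<^sup>2\<close>. What remains has integral
        0 by \<open>integral_flux\<close> applied to the square of \<open>u\<close>.\<close>
      have "?D \<omega> = (\<Sum>k\<in>unit_steps. p k \<omega> * (u (\<tau> k \<omega>))\<^sup>2 - 2 * u \<omega> * (p k \<omega> * u (\<tau> k \<omega>)) + p k \<omega> * (u \<omega>)\<^sup>2)"
        by (intro sum.cong) (auto simp: power2_eq_square algebra_simps)
      also have "\<dots> = (\<Sum>k\<in>unit_steps. p k \<omega> * (u (\<tau> k \<omega>))\<^sup>2) - 2 * u \<omega> * (total_rate p \<omega> * u \<omega>)
          + total_rate p \<omega> * (u \<omega>)\<^sup>2"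
        by (simp add: sum.distrib sum_subtractf elim sum_distrib_left[symmetric] sum_distrib_right[symmetric])
          (simp add: total_rate_def)
      finally show ?case by (simp add: power2_eq_square)
    qed
  qed (auto intro!: borel_measurable_sum borel_measurable_diff)
  also have "\<dots> = 0"
    using integral_flux[of "\<lambda>\<omega>. (u \<omega>)\<^sup>2" "B\<^sup>2", OF _ u2B] int2 int2k by simp
  finally have "AE \<omega> in M. ?D \<omega> = 0"
    by (subst (asm) integral_nonneg_eq_0_iff_AE)
       (auto intro!: intk sum_nonneg mult_nonneg_nonneg p_nonneg AE_I2)
  then have zero: "AE \<omega> in M. \<forall>k\<in>unit_steps. p k \<omega> * (u (\<tau> k \<omega>) - u \<omega>)\<^sup>2 = 0"
    using AE_space
    by eventually_elim (subst (asm) sum_nonneg_eq_0_iff, auto simp: finite_unit_steps p_nonneg)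
  show ?thesis
  proof (rule shift_invariant_AE_const[OF u uB, of thesis])
    fix k :: "int ^ 'd" assume k: "k \<in> unit_steps"
    show "AE \<omega> in M. u (\<tau> k \<omega>) = u \<omega>"
      using zero AE_shift[OF zero, of k] weakly_elliptic[unfolded weakly_elliptic_def] AE_space
    proof eventually_elim
      case (elim \<omega>)
      have "p k \<omega> * (u (\<tau> k \<omega>) - u \<omega>)\<^sup>2 = 0" using elim(1) k by blast
      \<comment> \<open>The vanishing summand at the neighbour \<open>\<tau> k \<omega>\<close> for
        the step \<open>- k\<close>, which leads back to \<omega>.\<close>
      moreover have "p (- k) (\<tau> k \<omega>) * (u \<omega> - u (\<tau> k \<omega>))\<^sup>2 = 0"
        using elim(2,4) k by (metis shift_uminus(2) unit_steps_uminus_iff)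
      moreover have "p k \<omega> + p (- k) (\<tau> k \<omega>) > 0" using elim(3) k by (force simp: sym_part_def)
      ultimately show ?case by auto
    qed
  qed (assumption | rule that)+
qed

end

section \<open>The space of jump sequences\<close>

text \<open>A point of \<open>path_space\<close> records the successive jumps, each with a flag telling whether
  the holding time before it exceeds 1.\<close>

definition path_space :: "(nat \<Rightarrow> (int ^ 'd) \<times> bool) measure" where
  "path_space = PiM UNIV (\<lambda>_. count_space UNIV)"

definition path_shift :: "(nat \<Rightarrow> 'b) \<Rightarrow> nat \<Rightarrow> 'b" where
  "path_shift z = (\<lambda>i. z (Suc i))"

text \<open>Flags are constrained only from one side because the law of the walk is given by tail
  probabilities of the holding times; a flag known to be false arises as a difference.\<close>

definition cylinder :: "nat \<Rightarrow> (nat \<Rightarrow> int ^ 'd) \<Rightarrow> (nat \<Rightarrow> bool) \<Rightarrow> (nat \<Rightarrow> (int ^ 'd) \<times> bool) set" where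
  "cylinder n k d = {z. \<forall>i<n. fst (z i) = k i \<and> (d i \<longrightarrow> snd (z i))}"

lemma space_path_space [simp]: "space path_space = UNIV"
  by (simp add: path_space_def space_PiM)

lemma path_coordinate_measurable: "(\<lambda>z. z i) \<in> measurable path_space (count_space UNIV)"
  unfolding path_space_def by (rule measurable_component_singleton) simp

lemma path_coordinate_measurable' [measurable]:
  "Measurable.pred path_space (\<lambda>z. R (z i))"
  "(\<lambda>z. f (z i)) \<in> borel_measurable path_space"
  by (rule measurable_compose[OF path_coordinate_measurable], simp)+

lemma path_shift_measurable [measurable]: "path_shift \<in> measurable path_space path_space"
  unfolding path_space_def path_shift_def[abs_def]
  by (rule measurable_PiM_single') (auto intro!: measurable_component_singleton)

lemma path_shift_funpow: "(path_shift ^^ n) z i = z (n + i)"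
  by (induction n arbitrary: i) (simp_all add: path_shift_def)

lemma cylinder_measurable [measurable]: "cylinder n k d \<in> sets path_space"
proof -
  have "{z \<in> space path_space. \<forall>i<n. fst (z i) = k i \<and> (d i \<longrightarrow> snd (z i))} \<in> sets path_space"
    by measurable
  then show ?thesis by (simp add: cylinder_def)
qed

text \<open>A common point forces the prescribed jumps to agree on the shared indices, and one-sided
  flag conditions simply accumulate. Cylinders with conflicting jumps are disjoint, hence the extra
  empty set in the generator.\<close>

lemma cylinder_Int_empty_or_cylinder:
  assumes "cylinder n k d \<inter> cylinder n' k' d' \<noteq> {}"
  shows "cylinder n k d \<inter> cylinder n' k' d' =
    cylinder (max n n') (\<lambda>i. if i < n then k i else k' i) (\<lambda>i. i < n \<and> d i \<or> i < n' \<and> d' i)"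
proof -
  obtain z where z: "z \<in> cylinder n k d" "z \<in> cylinder n' k' d'" using assms by blast
  have "k i = k' i" if "i < n" "i < n'" for i using z that by (auto simp: cylinder_def)
  then show ?thesis by (auto simp: cylinder_def less_max_iff_disj)
qed

lemma Int_stable_cylinders: "Int_stable (insert {} {cylinder n k d | n k d. True})"
proof (rule Int_stableI)
  fix a b :: "(nat \<Rightarrow> (int ^ 'd) \<times> bool) set"
  assume a: "a \<in> insert {} {cylinder n k d | n k d. True}" and b: "b \<in> insert {} {cylinder n k d | n k d. True}"
  show "a \<inter> b \<in> insert {} {cylinder n k d | n k d. True}"
  proof (cases "a \<inter> b = {}")
    case False
    then obtain n k d n' k' d' where "a = cylinder n k d" "b = cylinder n' k' d'" using a b by blast
    then show ?thesis using False cylinder_Int_empty_or_cylinder[of n k d n' k' d'] by auto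
  qed simp
qed

text \<open>An event on one coordinate is a countable union over the earlier jumps, because the
  lattice is countable.\<close>

lemma sets_path_space:
  "sets (path_space :: (nat \<Rightarrow> (int ^ 'd) \<times> bool) measure) =
    sigma_sets UNIV (insert {} {cylinder n k d | n k d. True})"
  (is "_ = sigma_sets UNIV ?G")
proof
  interpret sigma_algebra UNIV "sigma_sets UNIV ?G" by (rule sigma_algebra_sigma_sets) simp
  have above: "{z. fst (z i) = x \<and> (e \<longrightarrow> snd (z i))} \<in> sigma_sets UNIV ?G"
    for i and x :: "int ^ 'd" and e
  proof -
    let ?E = "{z. fst (z i) = x \<and> (e \<longrightarrow> snd (z i))}"
    let ?C = "\<lambda>k. cylinder (Suc i) (k(i := x)) (\<lambda>j. j = i \<and> e)"
    have "z \<in> ?C (restrict (fst \<circ> z) {..<i})" if "z \<in> ?E" for z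
      using that by (auto simp: cylinder_def less_Suc_eq)
    \<comment> \<open>Restricting the history to \<open>{..<i}\<close> makes the index set of the
      union countable.\<close>
    moreover have "restrict (fst \<circ> z) {..<i} \<in> PiE {..<i} (\<lambda>_. UNIV)" for z :: "nat \<Rightarrow> (int ^ 'd) \<times> bool"
      by auto
    moreover have "z \<in> ?E" if "z \<in> ?C k" for z k
      using that by (auto simp: cylinder_def)
    ultimately have "?E = (\<Union>k\<in>PiE {..<i} (\<lambda>_. UNIV). ?C k)" by blast
    also have "\<dots> \<in> sigma_sets UNIV ?G"
      by (intro countable_UN' countable_PiE) auto
    finally show ?thesis .
  qed
  have single: "{z. z i = v} \<in> sigma_sets UNIV ?G" for i and v :: "(int ^ 'd) \<times> bool"
  proof (cases "snd v")
    case True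
    then have "{z. z i = v} = {z. fst (z i) = fst v \<and> (True \<longrightarrow> snd (z i))}"
      by (auto simp: prod_eq_iff)
    then show ?thesis using above[of i "fst v" True] by simp
  next
    case False
    then have "{z. z i = v} = {z. fst (z i) = fst v \<and> (False \<longrightarrow> snd (z i))} -
        {z. fst (z i) = fst v \<and> (True \<longrightarrow> snd (z i))}"
      by (auto simp: prod_eq_iff)
    then show ?thesis using Diff[OF above[of i "fst v" False] above[of i "fst v" True]] by (simp only:)
  qed
  have coord: "{z. z i \<in> S} \<in> sigma_sets UNIV ?G" for i and S :: "((int ^ 'd) \<times> bool) set"
  proof -
    have "{z. z i \<in> S} = (\<Union>v\<in>S. {z. z i = v})" by auto
    also have "\<dots> \<in> sigma_sets UNIV ?G" using single by (intro countable_UN') auto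
    finally show ?thesis .
  qed
  show "sets path_space \<subseteq> sigma_sets UNIV ?G"
    unfolding path_space_def sets_PiM_single
    by (simp, rule sigma_sets_mono) (use coord in auto)
  show "sigma_sets UNIV ?G \<subseteq> sets path_space"
    using sets.sigma_sets_subset[of ?G path_space, unfolded space_path_space] cylinder_measurable
    by blast
qed

section \<open>The environment along the jump chain\<close>

text \<open>\<open>jump_prob\<close> at the origin of the environment, as a function of the
  displacement instead of the endpoint.\<close>

definition jump_kernel :: "(int ^ 'd \<Rightarrow> 'a \<Rightarrow> real) \<Rightarrow> 'a \<Rightarrow> int ^ 'd \<Rightarrow> real" where
  "jump_kernel p \<omega> k =
     (if total_rate p \<omega> = 0 then of_bool (k = 0)
      else if k \<in> unit_steps then p k \<omega> / total_rate p \<omega> else 0)"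

text \<open>\<open>L \<omega>\<close> stands for the quenched law of the jumps and flags. Moving the
  walk to another site appears as a translation of the environment, so the product formula is a
  Markov property for the environment seen from the walk.\<close>

locale environment_walk = random_environment M \<tau> p
  for M :: "'a measure" and \<tau> :: "int ^ 'd \<Rightarrow> 'a \<Rightarrow> 'a" and p :: "int ^ 'd \<Rightarrow> 'a \<Rightarrow> real" +
  fixes L :: "'a \<Rightarrow> (nat \<Rightarrow> (int ^ 'd) \<times> bool) measure"
  assumes L_kernel [measurable]: "L \<in> measurable M (prob_algebra path_space)"
    and L_cylinder: "\<And>\<omega> n k d. \<omega> \<in> space M \<Longrightarrow> measure (L \<omega>) (cylinder n k d) =
      (\<Prod>i<n. jump_kernel p (\<tau> (\<Sum>j<i. k j) \<omega>) (k i) *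
        exp (- (total_rate p (\<tau> (\<Sum>j<i. k j) \<omega>) * of_bool (d i))))"
begin

lemma L_prob_space: "\<omega> \<in> space M \<Longrightarrow> prob_space (L \<omega>)"
  and L_sets: "\<omega> \<in> space M \<Longrightarrow> sets (L \<omega>) = sets path_space"
  using measurable_space[OF L_kernel] by (auto simp: space_prob_algebra)

lemma L_space: "\<omega> \<in> space M \<Longrightarrow> space (L \<omega>) = UNIV"
  using sets_eq_imp_space_eq[OF L_sets] by simp

lemma L_measurable: "\<omega> \<in> space M \<Longrightarrow> measurable (L \<omega>) N = measurable path_space N"
  by (rule measurable_cong_sets[OF L_sets refl])

lemma L_subprob [measurable]: "L \<in> measurable M (subprob_algebra path_space)"
  by (rule measurable_prob_algebraD) simp

definition flag_prob :: "'a \<Rightarrow> bool \<Rightarrow> real" where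
  "flag_prob \<omega> e = (if e then exp (- total_rate p \<omega>) else 1 - exp (- total_rate p \<omega>))"

text \<open>On cylinders the first factor of the product formula splits off; uniqueness of finite
  measures on an intersection-stable generator extends this to every \<open>S\<close>.\<close>

lemma L_markov_lower:
  assumes \<omega>: "\<omega> \<in> space M" and S: "S \<in> sets path_space"
  shows "measure (L \<omega>) {z. fst (z 0) = x \<and> (e \<longrightarrow> snd (z 0)) \<and> path_shift z \<in> S} =
    jump_kernel p \<omega> x * exp (- (total_rate p \<omega> * of_bool e)) * measure (L (\<tau> x \<omega>)) S"
proof -
  interpret L: prob_space "L \<omega>" using \<omega> by (rule L_prob_space)
  interpret L': prob_space "L (\<tau> x \<omega>)" using \<omega> by (intro L_prob_space) simp
  note [simp] = L_sets[OF \<omega>] L_space[OF \<omega>] L_measurable[OF \<omega>]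
  define E where "E = {z :: nat \<Rightarrow> (int ^ 'd) \<times> bool. fst (z 0) = x \<and> (e \<longrightarrow> snd (z 0))}"
  define q where "q = jump_kernel p \<omega> x * exp (- (total_rate p \<omega> * of_bool e))"
  have q0: "0 \<le> q"
    using \<omega> by (auto simp: q_def jump_kernel_def p_nonneg total_rate_nonneg)
  have [measurable]: "E \<in> sets path_space"
  proof -
    have "{z \<in> space path_space. fst (z 0) = x \<and> (e \<longrightarrow> snd (z 0))} \<in> sets path_space" by measurable
    then show ?thesis by (simp add: E_def)
  qed
  define \<mu> where "\<mu> = distr (density (L \<omega>) (indicator E)) path_space path_shift"
  have \<mu>: "emeasure \<mu> U = emeasure (L \<omega>) (E \<inter> path_shift -` U)" if [measurable]: "U \<in> sets path_space" for U
  proof -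
    have [measurable]: "path_shift -` U \<in> sets path_space"
      using measurable_sets[OF path_shift_measurable that] by simp
    have "emeasure \<mu> U = (\<integral>\<^sup>+z. indicator E z * indicator (path_shift -` U) z \<partial>L \<omega>)"
      unfolding \<mu>_def by (simp add: emeasure_distr emeasure_density)
    also have "\<dots> = emeasure (L \<omega>) (E \<inter> path_shift -` U)"
      by (simp add: indicator_inter_arith[symmetric])
    finally show ?thesis .
  qed
  have cyl: "emeasure \<mu> (cylinder n k d) = emeasure (scale_measure q (L (\<tau> x \<omega>))) (cylinder n k d)" for n k d
  proof -
    let ?k = "case_nat x k" and ?d = "case_nat e d"
    have "E \<inter> path_shift -` cylinder n k d = cylinder (Suc n) ?k ?d"
      by (auto simp: E_def cylinder_def path_shift_def less_Suc_eq_0_disj)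
    moreover have "(\<Sum>j<Suc i. ?k j) = (\<Sum>j<i. k j) + x" for i
      by (subst sum.lessThan_Suc_shift) simp
    then have "measure (L \<omega>) (cylinder (Suc n) ?k ?d) = q * measure (L (\<tau> x \<omega>)) (cylinder n k d)"
      unfolding L_cylinder[OF \<omega>] L_cylinder[OF shift_space[OF \<omega>]]
      by (subst prod.lessThan_Suc_shift) (simp add: q_def shift_zero[OF \<omega>] shift_add[OF \<omega>] del: sum.lessThan_Suc)
    ultimately show ?thesis
      using q0 by (simp add: \<mu> L.emeasure_eq_measure L'.emeasure_eq_measure ennreal_mult)
  qed
  have "\<mu> = scale_measure q (L (\<tau> x \<omega>))"
  proof (rule measure_eqI_generator_eq[OF Int_stable_cylinders, where \<Omega>=UNIV and A="\<lambda>_. UNIV"])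
    show "sets \<mu> = sigma_sets UNIV (insert {} {cylinder n k d |n k d. True})"
      by (simp add: \<mu>_def sets_path_space)
    show "sets (scale_measure q (L (\<tau> x \<omega>))) = sigma_sets UNIV (insert {} {cylinder n k d |n k d. True})"
      using \<omega> by (simp add: L_sets sets_path_space)
    show "emeasure \<mu> X = emeasure (scale_measure q (L (\<tau> x \<omega>))) X"
      if "X \<in> insert {} {cylinder n k d |n k d. True}" for X
      using that cyl by auto
    have "UNIV = cylinder 0 undefined undefined" by (simp add: cylinder_def)
    then show "range (\<lambda>_. UNIV) \<subseteq> insert {} {cylinder n k d |n k d. True}" by blast
    have "UNIV \<in> sets (path_space :: (nat \<Rightarrow> (int ^ 'd) \<times> bool) measure)"
      using sets.top[of path_space] by simp
    then show "emeasure \<mu> UNIV \<noteq> \<infinity>" using L.emeasure_finite by (simp add: \<mu>)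
  qed auto
  then have "emeasure (L \<omega>) (E \<inter> path_shift -` S) = ennreal q * emeasure (L (\<tau> x \<omega>)) S"
    using \<mu>[OF S] by simp
  then have "measure (L \<omega>) (E \<inter> path_shift -` S) = q * measure (L (\<tau> x \<omega>)) S"
    using q0 by (simp add: measure_def enn2real_mult)
  moreover have "E \<inter> path_shift -` S = {z. fst (z 0) = x \<and> (e \<longrightarrow> snd (z 0)) \<and> path_shift z \<in> S}"
    by (auto simp: E_def)
  ultimately show ?thesis by (simp add: q_def)
qed

text \<open>A false flag is handled by subtracting the event with a true flag from the event without
  a flag condition.\<close>

lemma L_markov:
  assumes \<omega>: "\<omega> \<in> space M" and S [measurable]: "S \<in> sets path_space"
  shows "measure (L \<omega>) {z. z 0 = v \<and> path_shift z \<in> S} =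
    jump_kernel p \<omega> (fst v) * flag_prob \<omega> (snd v) * measure (L (\<tau> (fst v) \<omega>)) S"
proof (cases "snd v")
  case True
  then have "{z. z 0 = v \<and> path_shift z \<in> S} =
      {z. fst (z 0) = fst v \<and> (True \<longrightarrow> snd (z 0)) \<and> path_shift z \<in> S}"
    by (auto simp: prod_eq_iff)
  then show ?thesis using L_markov_lower[OF \<omega> S, of "fst v" True] True by (simp add: flag_prob_def)
next
  case False
  interpret L: prob_space "L \<omega>" using \<omega> by (rule L_prob_space)
  let ?E = "\<lambda>e. {z. fst (z 0) = fst v \<and> (e \<longrightarrow> snd (z 0)) \<and> path_shift z \<in> S}"
  have [measurable]: "?E e \<in> sets (L \<omega>)" for e
  proof -
    have "{z \<in> space path_space. fst (z 0) = fst v \<and> (e \<longrightarrow> snd (z 0)) \<and> path_shift z \<in> S} \<in> sets path_space"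
      by measurable
    then show ?thesis using \<omega> by (simp only: L_sets space_path_space UNIV_I simp_thms)
  qed
  have "{z. z 0 = v \<and> path_shift z \<in> S} = ?E False - ?E True"
    using False by (auto simp: prod_eq_iff)
  moreover have "measure (L \<omega>) (?E False - ?E True) = measure (L \<omega>) (?E False) - measure (L \<omega>) (?E True)"
    by (rule L.finite_measure_Diff[OF \<open>?E False \<in> _\<close> \<open>?E True \<in> _\<close>]) auto
  ultimately show ?thesis
    unfolding L_markov_lower[OF \<omega> S] using False by (simp add: flag_prob_def algebra_simps)
qed

lemma AE_L_unit_steps:
  assumes \<omega>: "\<omega> \<in> space M" and pos: "0 < total_rate p \<omega>"
  shows "AE z in L \<omega>. fst (z 0) \<in> unit_steps"
proof -
  interpret L: prob_space "L \<omega>" using \<omega> by (rule L_prob_space)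
  note [simp] = L_sets[OF \<omega>] L_space[OF \<omega>] L_measurable[OF \<omega>]
  have E [measurable]: "{z. R (z 0)} \<in> sets path_space" for R
    using path_coordinate_measurable'(1)[of R 0] by (simp add: pred_def L_sets[OF \<omega>])
  have 1: "measure (L \<omega>) {z. fst (z 0) = k} = p k \<omega> / total_rate p \<omega>" if "k \<in> unit_steps" for k
  proof -
    interpret L': prob_space "L (\<tau> k \<omega>)" using \<omega> by (intro L_prob_space) simp
    have "measure (L (\<tau> k \<omega>)) UNIV = 1" using L'.prob_space L_space[of "\<tau> k \<omega>"] \<omega> by simp
    then show ?thesis
      using L_markov_lower[OF \<omega>, of UNIV k False] sets.top[of path_space] that pos by (simp add: jump_kernel_def)
  qed
  have "measure (L \<omega>) (\<Union>k\<in>unit_steps. {z. fst (z 0) = k}) = (\<Sum>k\<in>unit_steps. p k \<omega> / total_rate p \<omega>)"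
    by (subst L.finite_measure_finite_Union)
       (auto simp: finite_unit_steps disjoint_family_on_def 1 E)
  also have "\<dots> = 1" using pos by (simp add: sum_divide_distrib[symmetric] total_rate_def)
  finally have "AE z in L \<omega>. z \<in> (\<Union>k\<in>unit_steps. {z. fst (z 0) = k})"
    by (subst (asm) L.prob_eq_1) (auto intro!: sets.finite_UN E simp: finite_unit_steps)
  then show ?thesis by eventually_elim auto
qed

text \<open>The factor \<open>total_rate p \<omega>\<close> cancels the normalisation of the jump
  kernel, so that the rates themselves appear, as in \<open>integral_flux\<close>.\<close>

lemma L_integral_first_step:
  assumes \<omega>: "\<omega> \<in> space M" and pos: "0 < total_rate p \<omega>" and S [measurable]: "S \<in> sets path_space"
  shows "total_rate p \<omega> * (\<integral>z. G (z 0) * indicator S (path_shift z) \<partial>L \<omega>) =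
    (\<Sum>k\<in>unit_steps. p k \<omega> * (\<Sum>e\<in>UNIV. G (k, e) * flag_prob \<omega> e) * measure (L (\<tau> k \<omega>)) S)"
proof -
  interpret L: prob_space "L \<omega>" using \<omega> by (rule L_prob_space)
  note [simp] = L_sets[OF \<omega>] L_space[OF \<omega>] L_measurable[OF \<omega>]
  let ?V = "unit_steps \<times> (UNIV :: bool set)"
  let ?E = "\<lambda>v. {z. z 0 = v \<and> path_shift z \<in> S}"
  have [measurable]: "?E v \<in> sets path_space" for v
  proof -
    have "{z \<in> space path_space. z 0 = v \<and> path_shift z \<in> S} \<in> sets path_space" by measurable
    then show ?thesis by simp
  qed
  have "(\<integral>z. G (z 0) * indicator S (path_shift z) \<partial>L \<omega>) =
      (\<integral>z. (\<Sum>v\<in>?V. G v * indicator (?E v) z) \<partial>L \<omega>)"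
  proof (rule integral_cong_AE)
    show "AE z in L \<omega>. G (z 0) * indicator S (path_shift z) = (\<Sum>v\<in>?V. G v * indicator (?E v) z)"
      using AE_L_unit_steps[OF \<omega> pos]
    proof eventually_elim
      case (elim z)
      then have "z 0 \<in> ?V" by (simp add: mem_Times_iff)
      then have "(\<Sum>v\<in>?V. G v * indicator (?E v) z) = G (z 0) * indicator (?E (z 0)) z"
        by (subst sum.remove[of _ "z 0"]) (auto simp: finite_unit_steps intro!: sum.neutral)
      then show ?case by (simp add: indicator_def)
    qed
  qed (unfold L_measurable[OF \<omega>], measurable)
  also have "\<dots> = (\<Sum>v\<in>?V. G v * measure (L \<omega>) (?E v))"
    by (subst Bochner_Integration.integral_sum)
       (auto simp: L.emeasure_eq_measure intro!: integrable_mult_right integrable_real_indicator)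
  also have "\<dots> = (\<Sum>k\<in>unit_steps. \<Sum>e\<in>UNIV. G (k, e) * measure (L \<omega>) (?E (k, e)))"
    by (simp add: sum.cartesian_product)
  also have "total_rate p \<omega> * \<dots> =
      (\<Sum>k\<in>unit_steps. p k \<omega> * (\<Sum>e\<in>UNIV. G (k, e) * flag_prob \<omega> e) * measure (L (\<tau> k \<omega>)) S)"
    unfolding sum_distrib_left sum_distrib_right
    by (intro sum.cong refl) (use pos in \<open>simp add: L_markov[OF \<omega> S] jump_kernel_def field_simps\<close>)
  finally show ?thesis .
qed

lemma flag_prob_measurable [measurable]: "(\<lambda>\<omega>. flag_prob \<omega> e) \<in> borel_measurable M"
  unfolding flag_prob_def by measurable

text \<open>A finite measure, left unnormalised. As the density is almost surely positive, it has
  the same null sets as the law of the jumps under the annealed measure.\<close>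

definition stationary_law :: "(nat \<Rightarrow> (int ^ 'd) \<times> bool) measure" where
  "stationary_law = density M (total_rate p) \<bind> L"

lemma sets_stationary_law [simp, measurable_cong]: "sets stationary_law = sets path_space"
  unfolding stationary_law_def using not_empty by (intro sets_bind) (auto simp: L_sets)

lemma space_stationary_law [simp]: "space stationary_law = UNIV"
  using sets_eq_imp_space_eq[OF sets_stationary_law] by simp

lemma finite_measure_density_total_rate: "finite_measure (density M (total_rate p))"
proof (rule finite_measureI)
  have "emeasure (density M (total_rate p)) (space M) = (\<integral>\<^sup>+\<omega>. total_rate p \<omega> \<partial>M)"
    by (auto simp: emeasure_density intro!: nn_integral_cong)
  also have "\<dots> < \<infinity>"
    using total_rate_integrable by (simp add: integrable_iff_bounded abs_of_nonneg total_rate_nonneg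
        cong: nn_integral_cong)
  finally show "emeasure (density M (total_rate p)) (space (density M (total_rate p))) \<noteq> \<infinity>" by simp
qed

lemma finite_measure_stationary_law: "finite_measure stationary_law"
proof (rule finite_measureI)
  have "emeasure stationary_law UNIV = (\<integral>\<^sup>+\<omega>. emeasure (L \<omega>) UNIV \<partial>density M (total_rate p))"
    unfolding stationary_law_def using not_empty sets.top[of "path_space"]
    by (intro emeasure_bind[where N=path_space]) auto
  also have "\<dots> = (\<integral>\<^sup>+\<omega>. 1 \<partial>density M (total_rate p))"
    by (intro nn_integral_cong) (use prob_space.emeasure_space_1[OF L_prob_space] L_space in auto)
  also have "\<dots> \<noteq> \<infinity>"
    using finite_measure.emeasure_finite[OF finite_measure_density_total_rate] by simp
  finally show "emeasure stationary_law (space stationary_law) \<noteq> \<infinity>" by simp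
qed

lemma integral_stationary_law:
  assumes f: "f \<in> borel_measurable path_space" and fB: "\<And>z. \<bar>f z\<bar> \<le> (B :: real)"
  shows "(\<integral>z. f z \<partial>stationary_law) = (\<integral>\<omega>. total_rate p \<omega> * (\<integral>z. f z \<partial>L \<omega>) \<partial>M)"
proof -
  have [measurable]: "L \<in> measurable (density M (total_rate p)) (subprob_algebra path_space)" by simp
  have [measurable]: "(\<lambda>\<omega>. \<integral>z. f z \<partial>L \<omega>) \<in> borel_measurable M"
    using measurable_compose[OF L_subprob integral_measurable_subprob_algebra[OF f]] by simp
  have "(\<integral>z. f z \<partial>stationary_law) = (\<integral>\<omega>. (\<integral>z. f z \<partial>L \<omega>) \<partial>density M (total_rate p))"
    unfolding stationary_law_def
  proof (rule integral_bind[OF f, where B'=1])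
    show "\<bar>f z\<bar> \<le> B" for z by (rule fB)
    show "AE \<omega> in density M (total_rate p). emeasure (L \<omega>) (space (L \<omega>)) \<le> ennreal 1"
      by (rule AE_I2) (simp add: prob_space.emeasure_space_1[OF L_prob_space])
  qed (auto intro: finite_measure_density_total_rate)
  also have "\<dots> = (\<integral>\<omega>. total_rate p \<omega> * (\<integral>z. f z \<partial>L \<omega>) \<partial>M)"
    by (subst integral_density) (auto simp: total_rate_nonneg)
  finally show ?thesis .
qed

lemma measure_L_measurable:
  "S \<in> sets path_space \<Longrightarrow> (\<lambda>\<omega>. measure (L \<omega>) S) \<in> borel_measurable M"
  using measurable_compose[OF L_kernel measurable_measure_prob_algebra] .

text \<open>The first step formula for the constant function 1. When \<open>S\<close> is
  shift-invariant, both sides involve the same function of the environment, which is therefore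
  harmonic.\<close>

lemma L_shift_harmonic:
  assumes S: "S \<in> sets path_space"
  shows "AE \<omega> in M. total_rate p \<omega> * measure (L \<omega>) (path_shift -` S) =
    (\<Sum>k\<in>unit_steps. p k \<omega> * measure (L (\<tau> k \<omega>)) S)"
  using AE_total_rate_pos AE_space
proof eventually_elim
  case (elim \<omega>)
  have "(\<integral>z. 1 * indicator S (path_shift z) \<partial>L \<omega>) = (\<integral>z. indicator (path_shift -` S) z \<partial>L \<omega> :: real)"
    by (simp add: indicator_vimage)
  also have "\<dots> = measure (L \<omega>) (path_shift -` S)" by (simp add: L_space elim)
  finally show ?case
    using L_integral_first_step[OF elim(2,1) S, of "\<lambda>_. 1"] by (simp add: flag_prob_def UNIV_bool)
qed

text \<open>Condition on the first jump, then apply the flux identity to the probability of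
  \<open>S\<close> as a function of the environment.\<close>

lemma stationary_law_invariant: "distr stationary_law stationary_law path_shift = stationary_law"
proof (rule measure_eqI)
  interpret Q: finite_measure stationary_law by (rule finite_measure_stationary_law)
  have eq: "measure stationary_law S = (\<integral>\<omega>. total_rate p \<omega> * measure (L \<omega>) S \<partial>M)"
    if S: "S \<in> sets path_space" for S
  proof -
    have "measure stationary_law S = (\<integral>z. indicator S z \<partial>stationary_law)" by simp
    also have "\<dots> = (\<integral>\<omega>. total_rate p \<omega> * (\<integral>z. indicator S z \<partial>L \<omega>) \<partial>M)"
      by (rule integral_stationary_law[where B=1]) (use S in \<open>auto simp: indicator_def\<close>)
    also have "\<dots> = (\<integral>\<omega>. total_rate p \<omega> * measure (L \<omega>) S \<partial>M)"
      by (intro Bochner_Integration.integral_cong) (simp_all add: L_space)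
    finally show ?thesis .
  qed
  fix S assume "S \<in> sets (distr stationary_law stationary_law path_shift)"
  then have S: "S \<in> sets path_space" by simp
  have S': "path_shift -` S \<in> sets path_space"
    using measurable_sets[OF path_shift_measurable S] by simp
  have bound: "\<bar>measure (L \<omega>) S\<bar> \<le> 1" if "\<omega> \<in> space M" for \<omega>
    using prob_space.prob_le_1[OF L_prob_space[OF that]] by simp
  have [measurable]: "(\<lambda>\<omega>. measure (L \<omega>) S) \<in> borel_measurable M"
    "(\<lambda>\<omega>. measure (L \<omega>) (path_shift -` S)) \<in> borel_measurable M"
    using S S' by (auto intro: measure_L_measurable)
  have "measure stationary_law (path_shift -` S)
      = (\<integral>\<omega>. total_rate p \<omega> * measure (L \<omega>) (path_shift -` S) \<partial>M)"
    by (rule eq[OF S'])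
  also have "\<dots> = (\<integral>\<omega>. (\<Sum>k\<in>unit_steps. p k \<omega> * measure (L (\<tau> k \<omega>)) S) \<partial>M)"
    by (rule integral_cong_AE[OF _ _ L_shift_harmonic[OF S]]) (auto intro!: borel_measurable_sum)
  also have "\<dots> = (\<integral>\<omega>. total_rate p \<omega> * measure (L \<omega>) S \<partial>M)"
    by (rule integral_flux[OF _ bound]) auto
  also have "\<dots> = measure stationary_law S" by (rule eq[OF S, symmetric])
  finally show "emeasure (distr stationary_law stationary_law path_shift) S = emeasure stationary_law S"
    using S by (simp add: emeasure_distr Q.emeasure_eq_measure)
qed simp

text \<open>The probability \<open>u\<close> of the shift-invariant event \<open>A\<close> that the sums are unbounded is
  harmonic, hence a constant \<open>c\<close>. So \<open>A\<close> is independent of the first step, and the maximal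
  inequality on \<open>A\<close> reads \<open>0 \<le> c * drift\<close>.\<close>

theorem AE_sums_bounded_above:
  fixes G :: "(int ^ 'd) \<times> bool \<Rightarrow> real"
  assumes GB: "\<And>v. \<bar>G v\<bar> \<le> B"
    and drift: "(\<integral>\<omega>. (\<Sum>k\<in>unit_steps. p k \<omega> * (\<Sum>e\<in>UNIV. G (k, e) * flag_prob \<omega> e)) \<partial>M) < 0"
  shows "AE \<omega> in M. AE z in L \<omega>. \<exists>K. \<forall>n. (\<Sum>i<n. G (z i)) \<le> K"
proof -
  \<comment> \<open>Thresholds in the naturals keep \<open>A\<close> a countable combination of
    measurable sets.\<close>
  define A where "A = {z :: nat \<Rightarrow> (int ^ 'd) \<times> bool. \<forall>K :: nat. \<exists>n. real K < (\<Sum>i<n. G (z i))}"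
  have A [measurable]: "A \<in> sets path_space"
  proof -
    have "{z \<in> space path_space. \<forall>K :: nat. \<exists>n. real K < (\<Sum>i<n. G (z i))} \<in> sets path_space"
      by measurable
    then show ?thesis by (simp add: A_def)
  qed
  have A_iff: "z \<in> A \<longleftrightarrow> (\<forall>K. \<exists>n. K < (\<Sum>i<n. G (z i)))" for z
  proof
    assume z: "z \<in> A"
    show "\<forall>K. \<exists>n. K < (\<Sum>i<n. G (z i))"
    proof
      fix K :: real
      obtain N :: nat where "K \<le> real N" using real_arch_simple by blast
      moreover obtain n where "real N < (\<Sum>i<n. G (z i))" using z by (auto simp: A_def)
      ultimately show "\<exists>n. K < (\<Sum>i<n. G (z i))" by (meson le_less_trans)
    qed
  qed (auto simp: A_def)
  have A_shift: "path_shift z \<in> A \<longleftrightarrow> z \<in> A" for z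
  proof -
    have S: "(\<Sum>i<Suc n. G (z i)) = G (z 0) + (\<Sum>i<n. G (path_shift z i))" for n
      by (subst sum.lessThan_Suc_shift) (simp add: path_shift_def)
    show ?thesis
    proof
      assume a: "path_shift z \<in> A"
      show "z \<in> A" unfolding A_iff
      proof
        fix K
        obtain n where "K - G (z 0) < (\<Sum>i<n. G (path_shift z i))" using a A_iff by blast
        then have "K < (\<Sum>i<Suc n. G (z i))" unfolding S by linarith
        then show "\<exists>n. K < (\<Sum>i<n. G (z i))" by blast
      qed
    next
      assume a: "z \<in> A"
      show "path_shift z \<in> A" unfolding A_iff
      proof
        fix K
        \<comment> \<open>The maximum with 0 rules out the empty sum, so \<open>n\<close> is a
          successor.\<close>
        obtain n where n: "max 0 (K + G (z 0)) < (\<Sum>i<n. G (z i))" using a A_iff by blast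
        then obtain m where "n = Suc m" by (cases n) auto
        then have "K < (\<Sum>i<m. G (path_shift z i))" using n S[of m] by simp
        then show "\<exists>n. K < (\<Sum>i<n. G (path_shift z i))" by blast
      qed
    qed
  qed
  then have A_vimage: "path_shift -` A = A" by auto
  define u where "u \<omega> = measure (L \<omega>) A" for \<omega>
  have u_measurable [measurable]: "u \<in> borel_measurable M"
    unfolding u_def[abs_def] using A by (rule measure_L_measurable)
  have u_bound: "\<bar>u \<omega>\<bar> \<le> 1" if "\<omega> \<in> space M" for \<omega>
    using prob_space.prob_le_1[OF L_prob_space[OF that]] by (simp add: u_def)
  have "AE \<omega> in M. total_rate p \<omega> * u \<omega> = (\<Sum>k\<in>unit_steps. p k \<omega> * u (\<tau> k \<omega>))"
    using L_shift_harmonic[OF A] by (simp add: u_def A_vimage)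
  then obtain c where c: "AE \<omega> in M. u \<omega> = c"
    using harmonic_AE_const[OF u_measurable u_bound] by blast
  have c_shift: "AE \<omega> in M. u (\<tau> k \<omega>) = c" for k
    using AE_shift[OF c] .
  have c0: "0 \<le> c"
  proof -
    have "AE \<omega> in M. 0 \<le> c" using c by eventually_elim (auto simp: u_def)
    then show ?thesis by simp
  qed
  have B0: "0 \<le> B" using GB[of undefined] by linarith
  let ?D = "\<lambda>\<omega>. \<Sum>k\<in>unit_steps. p k \<omega> * (\<Sum>e\<in>UNIV. G (k, e) * flag_prob \<omega> e)"
  have [measurable]: "?D \<in> borel_measurable M"
    by (intro borel_measurable_sum borel_measurable_times) auto
  have "0 \<le> (\<integral>z. indicator A z * G (z 0) \<partial>stationary_law)"
  proof (rule maximal_ergodic_inequality[OF finite_measure_stationary_law _ stationary_law_invariant])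
    show "\<bar>G (z 0)\<bar> \<le> B" for z :: "nat \<Rightarrow> (int ^ 'd) \<times> bool" by (rule GB)
    show "\<exists>n. 0 < (\<Sum>i<n. G ((path_shift ^^ i) z 0))" if "z \<in> A" for z
      using that by (simp add: path_shift_funpow A_iff)
  qed (auto simp: A_shift)
  also have "\<dots> = (\<integral>\<omega>. total_rate p \<omega> * (\<integral>z. indicator A z * G (z 0) \<partial>L \<omega>) \<partial>M)"
    by (rule integral_stationary_law[where B=B]) (auto simp: indicator_def GB B0)
  also have "\<dots> = (\<integral>\<omega>. c * ?D \<omega> \<partial>M)"
  proof (rule integral_cong_AE)
    show "(\<lambda>\<omega>. total_rate p \<omega> * (\<integral>z. indicator A z * G (z 0) \<partial>L \<omega>)) \<in> borel_measurable M"
    proof -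
      have "(\<lambda>z. indicator A z * G (z 0)) \<in> borel_measurable path_space" by measurable
      then have [measurable]: "(\<lambda>\<omega>. \<integral>z. indicator A z * G (z 0) \<partial>L \<omega>) \<in> borel_measurable M"
        by (intro measurable_compose[OF L_subprob] integral_measurable_subprob_algebra)
      show ?thesis by measurable
    qed
    have "AE \<omega> in M. \<forall>k\<in>unit_steps. u (\<tau> k \<omega>) = c"
      using c_shift by (simp add: AE_ball_countable countable_finite finite_unit_steps)
    then show "AE \<omega> in M. total_rate p \<omega> * (\<integral>z. indicator A z * G (z 0) \<partial>L \<omega>) = c * ?D \<omega>"
      using AE_total_rate_pos AE_space
    proof eventually_elim
      case (elim \<omega>)
      \<comment> \<open>Invariance of \<open>A\<close> moves its indicator behind the first step;
        conditioning then yields the factor \<open>u (\<tau> k \<omega>)\<close>, which is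
        \<open>c\<close> for every neighbour.\<close>
      have "(\<integral>z. indicator A z * G (z 0) \<partial>L \<omega>) = (\<integral>z. G (z 0) * indicator A (path_shift z) \<partial>L \<omega>)"
        by (intro Bochner_Integration.integral_cong) (auto simp: A_shift indicator_def)
      then show ?case
        using L_integral_first_step[OF elim(3,2) A, of G] elim(1)
        by (simp add: u_def sum_distrib_left mult_ac)
    qed
  qed measurable
  also have "\<dots> = c * (\<integral>\<omega>. ?D \<omega> \<partial>M)" by simp
  finally have "c = 0" using drift c0 by (simp add: zero_le_mult_iff)
  then have "AE \<omega> in M. u \<omega> = 0" using c by simp
  then show ?thesis using AE_space
  proof eventually_elim
    case (elim \<omega>)
    interpret L: prob_space "L \<omega>" using elim(2) by (rule L_prob_space)
    have "AE z in L \<omega>. z \<notin> A" using elim A by (simp add: u_def L.prob_eq_0 L_sets)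
    then show ?case
      by eventually_elim (auto simp: A_iff not_less)
  qed
qed

end

section \<open>Equality of the mean rates in opposite directions\<close>

context random_environment
begin

text \<open>The antisymmetry of \<open>h\<close> under \<open>l \<mapsto> - l\<close> makes the sum over \<open>l\<close> of the means of
  \<open>h k l\<close> equal to its own negative.\<close>

lemma divergence_form_integral_p:
  assumes div: "divergence_form M \<tau> p h"
    and h: "\<And>k l. k \<in> unit_steps \<Longrightarrow> l \<in> unit_steps \<Longrightarrow> integrable M (h k l)"
    and k: "k \<in> unit_steps"
  shows "(\<integral>\<omega>. p (- k) \<omega> \<partial>M) = (\<integral>\<omega>. p k \<omega> \<partial>M)"
proof -
  define H where "H l = (\<integral>\<omega>. h k l \<omega> \<partial>M)" for l
  have H: "H l = - H (- l)" if l: "l \<in> unit_steps" for l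
  proof -
    have int: "integrable M (h k (- l))" using h k l by simp
    have [measurable]: "h k l \<in> borel_measurable M" "h k (- l) \<in> borel_measurable M"
      using h k l by (auto intro!: borel_measurable_integrable)
    have "AE \<omega> in M. \<forall>k\<in>unit_steps. \<forall>l\<in>unit_steps. h k l \<omega> = - h (- k) l (\<tau> k \<omega>) \<and>
        h k l \<omega> = - h k (- l) (\<tau> l \<omega>) \<and> h k l \<omega> = - h l k \<omega>"
      using div unfolding divergence_form_def by (elim conjE)
    then have "AE \<omega> in M. h k l \<omega> = - h k (- l) (\<tau> l \<omega>)"
      by eventually_elim (use k l in blast)
    then have "H l = (\<integral>\<omega>. - h k (- l) (\<tau> l \<omega>) \<partial>M)"
      unfolding H_def by (intro integral_cong_AE) auto
    also have "\<dots> = - H (- l)" using integral_shift[OF int, of l] by (simp add: H_def)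
    finally show ?thesis .
  qed
  have "(\<Sum>l\<in>unit_steps. H l) = (\<Sum>l\<in>unit_steps. - H (- l))"
    by (intro sum.cong refl H)
  also have "\<dots> = - (\<Sum>l\<in>unit_steps. H l)"
    by (simp only: sum_negf sum_unit_steps_uminus[of H])
  finally have zero: "(\<Sum>l\<in>unit_steps. H l) = 0" by simp
  have k': "- k \<in> unit_steps" using k by simp
  have "(\<integral>\<omega>. antisym_part \<tau> p k \<omega> \<partial>M) = (\<integral>\<omega>. (\<Sum>l\<in>unit_steps. h k l \<omega>) \<partial>M)"
  proof (rule integral_cong_AE)
    have "AE \<omega> in M. \<forall>k\<in>unit_steps. antisym_part \<tau> p k \<omega> = (\<Sum>l\<in>unit_steps. h k l \<omega>)"
      using div unfolding divergence_form_def by (elim conjE)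
    then show "AE \<omega> in M. antisym_part \<tau> p k \<omega> = (\<Sum>l\<in>unit_steps. h k l \<omega>)"
      by eventually_elim (use k in blast)
    show "(\<lambda>\<omega>. \<Sum>l\<in>unit_steps. h k l \<omega>) \<in> borel_measurable M"
      using h k by (intro borel_measurable_sum borel_measurable_integrable)
    show "antisym_part \<tau> p k \<in> borel_measurable M"
      unfolding antisym_part_def[abs_def] using k k' by measurable
  qed
  also have "\<dots> = 0" using h k zero by (simp add: H_def)
  \<comment> \<open>By stationarity \<open>p (- k) (\<tau> k \<omega>)\<close> has the mean of
    \<open>p (- k)\<close>, so the mean of the antisymmetric part is half the difference of the two
    sides.\<close>
  finally show ?thesis
    using integrable_shift[OF p_integrable[OF k'], of k] integral_shift[OF p_integrable[OF k'], of k] k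
    by (simp add: antisym_part_def)
qed

end

section \<open>Sublinear displacement and frequency of long holding times\<close>

context environment_walk
begin

lemma AE_stationary_law_iff:
  assumes [measurable]: "Measurable.pred path_space R"
  shows "(AE z in stationary_law. R z) \<longleftrightarrow> (AE \<omega> in M. AE z in L \<omega>. R z)"
proof -
  have "(AE z in stationary_law. R z) \<longleftrightarrow> (AE \<omega> in density M (total_rate p). AE z in L \<omega>. R z)"
    unfolding stationary_law_def by (rule AE_bind[OF _ assms]) simp
  also have "\<dots> \<longleftrightarrow> (AE \<omega> in M. 0 < total_rate p \<omega> \<longrightarrow> (AE z in L \<omega>. R z))"
    by (subst AE_density) simp_all
  also have "\<dots> \<longleftrightarrow> (AE \<omega> in M. AE z in L \<omega>. R z)"
    using AE_total_rate_pos by (auto elim: eventually_elim2)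
  finally show ?thesis .
qed

text \<open>Stationarity carries the claim for the first jump to every later one, without following
  the positions of the walk.\<close>

lemma AE_jumps_unit: "AE \<omega> in M. AE z in L \<omega>. \<forall>j. fst (z j) \<in> unit_steps"
proof -
  have "AE \<omega> in M. AE z in L \<omega>. fst (z 0) \<in> unit_steps"
    using AE_total_rate_pos AE_space by eventually_elim (rule AE_L_unit_steps)
  then have 0: "AE z in stationary_law. fst (z 0) \<in> unit_steps"
    by (subst AE_stationary_law_iff) auto
  have "AE z in stationary_law. fst (z j) \<in> unit_steps" for j
  proof (induction j)
    case (Suc j)
    then have "AE z in distr stationary_law stationary_law path_shift. fst (z j) \<in> unit_steps"
      by (simp only: stationary_law_invariant)
    then have "AE z in stationary_law. fst (path_shift z j) \<in> unit_steps"
      by (rule AE_distrD[rotated]) measurable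
    then show ?case by (simp add: path_shift_def)
  qed (rule 0)
  then have "AE z in stationary_law. \<forall>j. fst (z j) \<in> unit_steps" by (simp add: AE_all_countable)
  then show ?thesis by (subst (asm) AE_stationary_law_iff) auto
qed

lemma sum_flag_prob: "(\<Sum>e\<in>UNIV. a * flag_prob \<omega> e) = a"
  by (simp add: UNIV_bool flag_prob_def algebra_simps)

lemma integral_total_rate_nonneg: "0 \<le> (\<integral>\<omega>. total_rate p \<omega> \<partial>M)"
  by (rule integral_nonneg_AE) (auto intro: total_rate_nonneg)

lemma integral_total_rate_pos: "0 < (\<integral>\<omega>. total_rate p \<omega> \<partial>M)"
proof (rule ccontr)
  assume "\<not> ?thesis"
  then have "(\<integral>\<omega>. total_rate p \<omega> \<partial>M) = 0" using integral_total_rate_nonneg by simp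
  then have "AE \<omega> in M. total_rate p \<omega> = 0"
    by (subst (asm) integral_nonneg_eq_0_iff_AE) (auto intro: total_rate_nonneg)
  then have "AE \<omega> in M. False" using AE_total_rate_pos by eventually_elim simp
  then show False by simp
qed

lemma AE_long_holding_times_frequent:
  obtains \<delta> where "0 < \<delta>"
    "AE \<omega> in M. AE z in L \<omega>. \<exists>K. \<forall>n. \<delta> * real n - (\<Sum>j<n. of_bool (snd (z j))) \<le> K"
proof -
  have bound: "\<bar>total_rate p \<omega> * exp (- total_rate p \<omega>)\<bar> \<le> total_rate p \<omega>" if "\<omega> \<in> space M" for \<omega>
    using total_rate_nonneg[OF that] by (simp add: abs_mult mult_left_le)
  have int: "integrable M (\<lambda>\<omega>. total_rate p \<omega> * exp (- total_rate p \<omega>))"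
    by (rule Bochner_Integration.integrable_bound[OF total_rate_integrable])
       (use bound total_rate_nonneg in auto)
  define a where "a = (\<integral>\<omega>. total_rate p \<omega> * exp (- total_rate p \<omega>) \<partial>M)"
  define m where "m = (\<integral>\<omega>. total_rate p \<omega> \<partial>M)"
  have m: "0 < m" unfolding m_def by (rule integral_total_rate_pos)
  have a: "0 < a"
  proof (rule ccontr)
    assume "\<not> 0 < a"
    moreover have "0 \<le> a"
      unfolding a_def by (rule integral_nonneg_AE) (auto intro!: AE_I2 mult_nonneg_nonneg total_rate_nonneg)
    ultimately have "a = 0" by simp
    then have "AE \<omega> in M. total_rate p \<omega> * exp (- total_rate p \<omega>) = 0"
      unfolding a_def by (subst (asm) integral_nonneg_eq_0_iff_AE[OF int])
        (auto intro!: AE_I2 mult_nonneg_nonneg total_rate_nonneg)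
    then have "AE \<omega> in M. False" using AE_total_rate_pos by eventually_elim simp
    then show False by simp
  qed
  \<comment> \<open>\<open>a / m\<close> is the stationary frequency of holding times above 1;
    taking half of it leaves the negative mean \<open>- a / 2\<close>.\<close>
  define \<delta> where "\<delta> = a / (2 * m)"
  have \<delta>: "0 < \<delta>" using a m by (simp add: \<delta>_def)
  define G :: "(int ^ 'd) \<times> bool \<Rightarrow> real" where "G v = \<delta> - of_bool (snd v)" for v
  have "(\<integral>\<omega>. (\<Sum>k\<in>unit_steps. p k \<omega> * (\<Sum>e\<in>UNIV. G (k, e) * flag_prob \<omega> e)) \<partial>M) =
      (\<integral>\<omega>. \<delta> * total_rate p \<omega> - total_rate p \<omega> * exp (- total_rate p \<omega>) \<partial>M)"
  proof (rule Bochner_Integration.integral_cong[OF refl])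
    fix \<omega>
    have "(\<Sum>e\<in>UNIV. G (k, e) * flag_prob \<omega> e) = \<delta> - exp (- total_rate p \<omega>)" for k
      by (simp add: UNIV_bool flag_prob_def G_def algebra_simps)
    then have "(\<Sum>k\<in>unit_steps. p k \<omega> * (\<Sum>e\<in>UNIV. G (k, e) * flag_prob \<omega> e)) =
        total_rate p \<omega> * (\<delta> - exp (- total_rate p \<omega>))"
      by (simp only: sum_distrib_right[symmetric] total_rate_def[of p, symmetric])
    then show "(\<Sum>k\<in>unit_steps. p k \<omega> * (\<Sum>e\<in>UNIV. G (k, e) * flag_prob \<omega> e)) =
        \<delta> * total_rate p \<omega> - total_rate p \<omega> * exp (- total_rate p \<omega>)"
      by (simp add: algebra_simps)
  qed
  also have "\<dots> = \<delta> * m - a" using int by (simp add: a_def m_def)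
  also have "\<dots> < 0" using a m by (simp add: \<delta>_def)
  finally have "AE \<omega> in M. AE z in L \<omega>. \<exists>K. \<forall>n. (\<Sum>i<n. G (z i)) \<le> K"
    by (intro AE_sums_bounded_above[where B="\<delta> + 1"]) (use \<delta> in \<open>auto simp: G_def\<close>)
  then have "AE \<omega> in M. AE z in L \<omega>. \<exists>K. \<forall>n. \<delta> * real n - (\<Sum>j<n. of_bool (snd (z j))) \<le> K"
    by (simp add: G_def sum_subtractf mult.commute)
  with \<delta> show ?thesis by (rule that)
qed

text \<open>Pairing \<open>k\<close> with \<open>- k\<close> cancels the mean displacement, so
  charging \<epsilon> per jump leaves minus \<epsilon> times the mean total rate.\<close>

lemma AE_displacement_sublinear:
  assumes sym: "\<And>k. k \<in> unit_steps \<Longrightarrow> (\<integral>\<omega>. p (- k) \<omega> \<partial>M) = (\<integral>\<omega>. p k \<omega> \<partial>M)"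
    and s: "\<bar>s\<bar> = 1" and \<epsilon>: "0 < \<epsilon>"
  shows "AE \<omega> in M. AE z in L \<omega>. \<exists>K. \<forall>n. s * (\<Sum>j<n. real_of_int (fst (z j) $ i)) \<le> \<epsilon> * real n + K"
proof -
  \<comment> \<open>The value 0 off the unit steps makes \<open>G\<close> bounded everywhere; almost
    surely no jump meets this case.\<close>
  define G :: "(int ^ 'd) \<times> bool \<Rightarrow> real"
    where "G v = (if fst v \<in> unit_steps then s * real_of_int (fst v $ i) else 0) - \<epsilon>" for v
  let ?x = "\<lambda>k. s * real_of_int (k $ i)"
  have x: "\<bar>?x k\<bar> \<le> 1" if "k \<in> unit_steps" for k :: "int ^ 'd"
    using unit_steps_component_le[OF that, of i] s by (simp add: abs_mult)
  have GB: "\<bar>G v\<bar> \<le> 1 + \<epsilon>" for v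
    using x[of "fst v"] \<epsilon> by (auto simp: G_def)
  define X where "X = (\<Sum>k\<in>unit_steps. ?x k * (\<integral>\<omega>. p k \<omega> \<partial>M))"
  have "X = (\<Sum>k\<in>unit_steps. ?x (- k) * (\<integral>\<omega>. p (- k) \<omega> \<partial>M))"
    unfolding X_def by (rule sum_unit_steps_uminus[symmetric])
  also have "\<dots> = - X" unfolding X_def sum_negf[symmetric] by (intro sum.cong) (auto simp: sym)
  finally have X: "X = 0" by simp
  have "(\<integral>\<omega>. (\<Sum>k\<in>unit_steps. p k \<omega> * (\<Sum>e\<in>UNIV. G (k, e) * flag_prob \<omega> e)) \<partial>M) =
      (\<integral>\<omega>. (\<Sum>k\<in>unit_steps. ?x k * p k \<omega>) - \<epsilon> * total_rate p \<omega> \<partial>M)"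
  proof (rule Bochner_Integration.integral_cong[OF refl])
    fix \<omega>
    have "(\<Sum>e\<in>UNIV. G (k, e) * flag_prob \<omega> e) = ?x k - \<epsilon>" if "k \<in> unit_steps" for k
      using sum_flag_prob[of "?x k - \<epsilon>" \<omega>] that by (simp add: G_def)
    then have "(\<Sum>k\<in>unit_steps. p k \<omega> * (\<Sum>e\<in>UNIV. G (k, e) * flag_prob \<omega> e)) =
        (\<Sum>k\<in>unit_steps. ?x k * p k \<omega> - \<epsilon> * p k \<omega>)"
      by (intro sum.cong refl) (simp only: right_diff_distrib mult.commute)
    then show "(\<Sum>k\<in>unit_steps. p k \<omega> * (\<Sum>e\<in>UNIV. G (k, e) * flag_prob \<omega> e)) =
        (\<Sum>k\<in>unit_steps. ?x k * p k \<omega>) - \<epsilon> * total_rate p \<omega>"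
      by (simp add: sum_subtractf total_rate_def sum_distrib_left)
  qed
  also have "\<dots> = X - \<epsilon> * (\<integral>\<omega>. total_rate p \<omega> \<partial>M)"
    by (simp add: X_def)
  also have "\<dots> < 0" using X \<epsilon> integral_total_rate_pos by simp
  finally have "AE \<omega> in M. AE z in L \<omega>. \<exists>K. \<forall>n. (\<Sum>i<n. G (z i)) \<le> K"
    by (intro AE_sums_bounded_above[OF GB])
  then show ?thesis using AE_jumps_unit
  proof eventually_elim
    case (elim \<omega>)
    then show ?case
    proof eventually_elim
      case (elim z)
      then obtain K where K: "\<And>n. (\<Sum>j<n. G (z j)) \<le> K" by blast
      have "(\<Sum>j<n. G (z j)) = s * (\<Sum>j<n. real_of_int (fst (z j) $ i)) - \<epsilon> * real n" for n
        using elim(2) by (simp add: G_def sum_subtractf sum_distrib_left mult.commute)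
      then have "s * (\<Sum>j<n. real_of_int (fst (z j) $ i)) \<le> \<epsilon> * real n + K" for n
        using K[of n] by (metis diff_le_eq add.commute)
      then show ?case by blast
    qed
  qed
qed

end

section \<open>Jump chain and holding times\<close>

text \<open>The displacement 0 is included for absorbing sites, where the jump chain stays
  put.\<close>

lemma sum_jump_prob: "(\<Sum>k\<in>insert 0 unit_steps. jump_prob c x (x + k)) = 1"
  by (auto simp: jump_prob_def exit_rate_def finite_unit_steps sum_divide_distrib[symmetric])

text \<open>Both facts are implicit in the cylinder formula with all thresholds 0. Adding the
  condition \<open>0 < T (Suc n) w\<close> to a history and summing over the next jump gives back
  the full mass of that history, and there are only countably many histories.\<close>

lemma
  assumes walk: "markov_jump_walk N c x0 Y T X"
  shows AE_initial_position: "AE w in N. Y 0 w = x0"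
    and AE_holding_times_pos: "AE w in N. \<forall>n. 0 < T n w"
proof -
  interpret N: prob_space N using walk by (simp add: markov_jump_walk_def)
  have [measurable]: "Y n \<in> measurable N (count_space UNIV)" "T n \<in> borel_measurable N" for n
    using walk by (auto simp: markov_jump_walk_def)
  let ?E = "\<lambda>n y. {w \<in> space N. \<forall>i\<le>n. Y i w = y i \<and> 0 < T i w}"
  have law: "measure N (?E n y) = of_bool (y 0 = x0) * (\<Prod>i<n. jump_prob c (y i) (y (Suc i)))" for n y
  proof -
    have "measure N {w \<in> space N. \<forall>i\<le>n. Y i w = y i \<and> ennreal 0 < T i w} =
        of_bool (y 0 = x0) * (\<Prod>i<n. jump_prob c (y i) (y (Suc i))) *
          (\<Prod>i\<le>n. exp (- (exit_rate c (y i) * 0)))"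
      using walk unfolding markov_jump_walk_def by (elim conjE allE[of _ n] allE[of _ y] allE[of _ "\<lambda>_. 0"]) simp
    then show ?thesis by simp
  qed
  have "measure N (?E 0 (\<lambda>_. x0)) = 1" unfolding law by simp
  then have start: "AE w in N. w \<in> ?E 0 (\<lambda>_. x0)" by (simp add: N.prob_eq_1)
  then show "AE w in N. Y 0 w = x0" by eventually_elim simp
  have step: "AE w in N. w \<in> ?E n y \<longrightarrow> 0 < T (Suc n) w" for n y
  proof -
    let ?F = "\<lambda>k. ?E (Suc n) (y(Suc n := y n + k))"
    have "measure N (?E n y) = measure N (?E n y) * (\<Sum>k\<in>insert 0 unit_steps. jump_prob c (y n) (y n + k))"
      by (simp only: sum_jump_prob mult_1_right)
    also have "\<dots> = (\<Sum>k\<in>insert 0 unit_steps. measure N (?F k))"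
      unfolding sum_distrib_left law by (intro sum.cong) (auto simp: mult.assoc)
    also have "\<dots> = measure N (\<Union>k\<in>insert 0 unit_steps. ?F k)"
      by (rule N.finite_measure_finite_Union[symmetric])
         (auto simp: finite_unit_steps disjoint_family_on_def)
    also have "\<dots> \<le> measure N {w \<in> space N. w \<in> ?E n y \<and> 0 < T (Suc n) w}"
      by (rule N.finite_measure_mono) (auto simp: le_Suc_eq split: if_splits)
    finally have "measure N {w \<in> space N. w \<in> ?E n y \<and> 0 < T (Suc n) w} = measure N (?E n y)"
      by (intro antisym[OF N.finite_measure_mono]) auto
    then have "measure N (?E n y - {w \<in> space N. w \<in> ?E n y \<and> 0 < T (Suc n) w}) = 0"
      by (subst N.finite_measure_Diff) auto
    then have "AE w in N. w \<notin> ?E n y - {w \<in> space N. w \<in> ?E n y \<and> 0 < T (Suc n) w}"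
      by (subst (asm) N.prob_eq_0) auto
    then show ?thesis using AE_space by eventually_elim (auto simp: zero_less_iff_neq_zero)
  qed
  have "AE w in N. \<forall>i\<le>n. 0 < T i w" for n
  proof (induction n)
    case 0
    show ?case using start by eventually_elim simp
  next
    case (Suc n)
    have "AE w in N. \<forall>y\<in>PiE {..n} (\<lambda>_. UNIV). w \<in> ?E n y \<longrightarrow> 0 < T (Suc n) w"
      using step by (subst AE_ball_countable) (auto intro: countable_PiE)
    then show ?case using Suc AE_space
    proof eventually_elim
      case (elim w)
      have "restrict (\<lambda>i. Y i w) {..n} \<in> PiE {..n} (\<lambda>_. UNIV)" by auto
      from bspec[OF elim(1) this] have "0 < T (Suc n) w" using elim by simp
      then show ?case using elim by (simp add: le_Suc_eq)
    qed
  qed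
  then have "AE w in N. \<forall>n. \<forall>i\<le>n. 0 < T i w" by (subst AE_all_countable) blast
  then show "AE w in N. \<forall>n. 0 < T n w" by eventually_elim blast
qed

text \<open>Translates the law from positions to increments, the initial position being almost
  surely known.\<close>

lemma jump_cylinder_law:
  assumes walk: "markov_jump_walk N c x0 Y T X"
  shows "measure N {w \<in> space N. \<forall>i<n. Y (Suc i) w - Y i w = k i \<and> (d i \<longrightarrow> 1 < T i w)} =
    (\<Prod>i<n. jump_prob c (x0 + (\<Sum>j<i. k j)) (x0 + (\<Sum>j<i. k j) + k i) *
      exp (- (exit_rate c (x0 + (\<Sum>j<i. k j)) * of_bool (d i))))"
proof -
  interpret N: prob_space N using walk by (simp add: markov_jump_walk_def)
  have [measurable]: "Y n \<in> measurable N (count_space UNIV)" "T n \<in> borel_measurable N" for n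
    using walk by (auto simp: markov_jump_walk_def)
  define y where "y i = x0 + (\<Sum>j<i. k j)" for i
  \<comment> \<open>The formula for the walk also constrains the holding time at index
    \<open>n\<close>, one beyond the cylinder. The threshold 0, there and at unflagged indices, is
    an almost surely empty condition and gives the exponential factor 1.\<close>
  define t :: "nat \<Rightarrow> real" where "t i = of_bool (i < n \<and> d i)" for i
  have "measure N {w \<in> space N. \<forall>i<n. Y (Suc i) w - Y i w = k i \<and> (d i \<longrightarrow> 1 < T i w)} =
      measure N {w \<in> space N. \<forall>i\<le>n. Y i w = y i \<and> ennreal (t i) < T i w}"
  proof (rule measure_eq_AE)
    show "AE w in N. w \<in> {w \<in> space N. \<forall>i<n. Y (Suc i) w - Y i w = k i \<and> (d i \<longrightarrow> 1 < T i w)} \<longleftrightarrow>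
        w \<in> {w \<in> space N. \<forall>i\<le>n. Y i w = y i \<and> ennreal (t i) < T i w}"
      using AE_initial_position[OF walk] AE_holding_times_pos[OF walk] AE_space
    proof eventually_elim
      case (elim w)
      have "(\<forall>i<n. Y (Suc i) w - Y i w = k i) \<longleftrightarrow> (\<forall>i\<le>n. Y i w = y i)"
      proof
        assume a: "\<forall>i<n. Y (Suc i) w - Y i w = k i"
        show "\<forall>i\<le>n. Y i w = y i"
        proof (intro allI impI)
          fix i assume "i \<le> n"
          then show "Y i w = y i"
          proof (induction i)
            case 0 then show ?case using elim by (simp add: y_def)
          next
            case (Suc i)
            then have "Y (Suc i) w = Y i w + k i" using a by (metis Suc_le_lessD diff_add_cancel add.commute)
            then show ?case using Suc by (simp add: y_def)
          qed
        qed
      qed (auto simp: y_def)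
      moreover have "(\<forall>i<n. d i \<longrightarrow> 1 < T i w) \<longleftrightarrow> (\<forall>i\<le>n. ennreal (t i) < T i w)"
        using elim(2) by (auto simp: t_def)
      ultimately show ?case using elim(3) by auto
    qed
  qed measurable
  also have "\<dots> = of_bool (y 0 = x0) * (\<Prod>i<n. jump_prob c (y i) (y (Suc i))) *
      (\<Prod>i\<le>n. exp (- (exit_rate c (y i) * t i)))"
    using walk unfolding markov_jump_walk_def
    by (elim conjE allE[of _ n] allE[of _ y] allE[of _ t]) (simp add: t_def)
  also have "(\<Prod>i\<le>n. exp (- (exit_rate c (y i) * t i))) = (\<Prod>i<n. exp (- (exit_rate c (y i) * of_bool (d i))))"
    unfolding lessThan_Suc_atMost[symmetric] by (simp add: t_def)
  finally show ?thesis
    by (simp add: y_def prod.distrib add.assoc)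
qed

text \<open>The pathwise time change: linear growth of the jump times allows at most
  \<open>(t + K) / \<delta>\<close> jumps by time \<open>t\<close>, and displacement is sublinear in
  the number of jumps.\<close>

lemma jump_walk_speed_zero:
  fixes y :: "nat \<Rightarrow> int ^ 'd" and x :: "real \<Rightarrow> int ^ 'd" and J :: "nat \<Rightarrow> ennreal"
  assumes J0: "J 0 = 0" and \<delta>: "0 < \<delta>" and J: "\<And>n. ennreal (\<delta> * real n - K) \<le> J n"
    and x: "\<And>n t. 0 \<le> t \<Longrightarrow> J n \<le> ennreal t \<Longrightarrow> ennreal t < J (Suc n) \<Longrightarrow> x t = y n"
    and y: "\<And>i \<epsilon>. 0 < \<epsilon> \<Longrightarrow> \<exists>C. \<forall>n. \<bar>real_of_int (y n $ i)\<bar> \<le> \<epsilon> * real n + C"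
  shows "((\<lambda>t. (1 / t) *\<^sub>R lattice_vec (x t)) \<longlongrightarrow> 0) at_top"
proof (rule vec_tendstoI)
  fix i
  have at: "\<exists>n. x t = y n \<and> real n \<le> (t + K) / \<delta>" if t: "0 \<le> t" for t
  proof -
    obtain m :: nat where "(t + K) / \<delta> < real m" using reals_Archimedean2 by blast
    then have "t < \<delta> * real m - K" using \<delta> by (simp add: field_simps)
    then have "ennreal t < J m" using J[of m] t by (meson ennreal_lessI le_less_trans less_le_trans)
    then have ex: "\<exists>m. ennreal t < J m" by blast
    \<comment> \<open>The first jump after time \<open>t\<close>, which exists because the jump
      times are unbounded. It is not number 0 since \<open>J 0\<close> is 0, and its predecessor
      opens the interval containing \<open>t\<close>.\<close>
    define m where "m = (LEAST m. ennreal t < J m)"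
    have m: "ennreal t < J m" unfolding m_def using ex by (rule LeastI_ex)
    then obtain n where n: "m = Suc n" using J0 by (cases m) auto
    then have "\<not> ennreal t < J n" unfolding m_def by (metis lessI not_less_Least)
    then have le: "J n \<le> ennreal t" by simp
    then have "ennreal (\<delta> * real n - K) \<le> ennreal t" using J order_trans by blast
    then have "\<delta> * real n - K \<le> t" using t by (simp add: ennreal_le_iff)
    then have "real n \<le> (t + K) / \<delta>" using \<delta> by (simp add: field_simps)
    moreover have "x t = y n" using x[OF t le] m n by simp
    ultimately show ?thesis by blast
  qed
  show "((\<lambda>t. ((1 / t) *\<^sub>R lattice_vec (x t)) $ i) \<longlongrightarrow> 0 $ i) at_top"
    unfolding tendsto_iff
  proof (intro allI impI)
    fix e :: real assume e: "0 < e"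
    \<comment> \<open>With at most \<open>(t + K) / \<delta>\<close> jumps, this choice bounds
      \<open>\<epsilon> * n\<close> by \<open>e * t / 2 + e * K / 2\<close>; for large
      \<open>t\<close> the constants are absorbed by the other half of \<open>e * t\<close>.\<close>
    define \<epsilon> where "\<epsilon> = e * \<delta> / 2"
    have \<epsilon>: "0 < \<epsilon>" using e \<delta> by (simp add: \<epsilon>_def)
    obtain C where C: "\<And>n. \<bar>real_of_int (y n $ i)\<bar> \<le> \<epsilon> * real n + C" using y[OF \<epsilon>] by blast
    have "\<forall>\<^sub>F t in at_top. max 0 (2 * (e * K / 2 + C) / e) < t" by (rule eventually_gt_at_top)
    then show "\<forall>\<^sub>F t in at_top. dist (((1 / t) *\<^sub>R lattice_vec (x t)) $ i) (0 $ i) < e"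
    proof eventually_elim
      case (elim t)
      then have t: "0 < t" and tC: "e * K / 2 + C < e * t / 2" using e by (auto simp: field_simps)
      obtain n where n: "x t = y n" "real n \<le> (t + K) / \<delta>" using at[of t] t by auto
      have "\<bar>real_of_int (x t $ i)\<bar> \<le> \<epsilon> * ((t + K) / \<delta>) + C"
        using C[of n] mult_left_mono[OF n(2), of \<epsilon>] \<epsilon> n(1) by simp
      also have "\<dots> = e * t / 2 + (e * K / 2 + C)" using \<delta> by (simp add: \<epsilon>_def field_simps)
      also have "\<dots> < e * t" using tC by simp
      finally show ?case using t by (simp add: lattice_vec_def dist_real_def field_simps abs_mult)
    qed
  qed
qed

section \<open>From the quenched walk to the environment seen from it\<close>

lemma exit_rate_environment: "exit_rate (environment_rates \<tau> p \<omega>) x = total_rate p (\<tau> x \<omega>)"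
  by (simp add: exit_rate_def total_rate_def environment_rates_def)

lemma jump_prob_environment:
  "jump_prob (environment_rates \<tau> p \<omega>) x (x + k) = jump_kernel p (\<tau> x \<omega>) k"
  unfolding jump_prob_def jump_kernel_def exit_rate_environment
  by (simp add: environment_rates_def)

theorem proposition1:
  fixes M :: "'a measure"
    and \<tau> :: "int ^ 'd \<Rightarrow> 'a \<Rightarrow> 'a"
    and p :: "int ^ 'd \<Rightarrow> 'a \<Rightarrow> real"
    and h :: "int ^ 'd \<Rightarrow> int ^ 'd \<Rightarrow> 'a \<Rightarrow> real"
    and W :: "'w measure"
    and P :: "'a \<Rightarrow> 'w measure"
    and Y :: "nat \<Rightarrow> 'w \<Rightarrow> int ^ 'd"
    and T :: "nat \<Rightarrow> 'w \<Rightarrow> ennreal"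
    and X :: "real \<Rightarrow> 'w \<Rightarrow> int ^ 'd"
  assumes "prob_space M"
    and "ergodic_action M \<tau>"
    and "\<And>k. k \<in> unit_steps \<Longrightarrow> p k \<in> borel_measurable M"
    and "\<And>k \<omega>. k \<in> unit_steps \<Longrightarrow> \<omega> \<in> space M \<Longrightarrow> 0 \<le> p k \<omega>"
    and "bistochastic M \<tau> p"
    and "weakly_elliptic M \<tau> p"
    and "divergence_form M \<tau> p h"
    and "P \<in> measurable M (prob_algebra W)"
    and "\<And>\<omega>. \<omega> \<in> space M \<Longrightarrow> markov_jump_walk (P \<omega>) (environment_rates \<tau> p \<omega>) 0 Y T X"
    and "\<And>k. k \<in> unit_steps \<Longrightarrow> square_integrable M (\<lambda>\<omega>. sqrt (sym_part \<tau> p k \<omega>))"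
    and "\<And>k l. k \<in> unit_steps \<Longrightarrow> l \<in> unit_steps \<Longrightarrow> integrable M (h k l)"
  shows "AE w in annealed M P. ((\<lambda>t. (1 / t) *\<^sub>R lattice_vec (X t w)) \<longlongrightarrow> 0) at_top"
proof -
  note p_measurable = assms(3) and p_nonneg = assms(4) and P = assms(8) and walk = assms(9)
  interpret prob_space M by fact
  have shift: "\<tau> z \<in> measurable M M" for z
    using assms(2) by (simp add: ergodic_action_def measure_preserving_action_def)
  \<comment> \<open>Nonnegativity of both rates bounds \<open>p k\<close> by twice the symmetric
    part, the square of \<open>r k\<close>.\<close>
  have integrable: "integrable M (p k)" if k: "k \<in> unit_steps" for k
  proof -
    have nonneg: "0 \<le> p k \<omega>" "0 \<le> p (- k) (\<tau> k \<omega>)" if "\<omega> \<in> space M" for \<omega>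
      using p_nonneg k that measurable_space[OF shift that] by auto
    have "integrable M (\<lambda>\<omega>. (sqrt (sym_part \<tau> p k \<omega>))\<^sup>2)"
      using assms(10)[OF k] by (simp add: square_integrable_def)
    moreover have "(sqrt (sym_part \<tau> p k \<omega>))\<^sup>2 = sym_part \<tau> p k \<omega>" if "\<omega> \<in> space M" for \<omega>
      using nonneg[OF that] by (simp add: sym_part_def)
    ultimately have "integrable M (sym_part \<tau> p k)"
      by (simp cong: Bochner_Integration.integrable_cong)
    then have "integrable M (\<lambda>\<omega>. 2 * sym_part \<tau> p k \<omega>)" by simp
    then show ?thesis
    proof (rule Bochner_Integration.integrable_bound)
      show "AE \<omega> in M. norm (p k \<omega>) \<le> norm (2 * sym_part \<tau> p k \<omega>)"
        using nonneg by (intro AE_I2) (auto simp: sym_part_def)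
    qed (rule p_measurable[OF k])
  qed
  interpret random_environment M \<tau> p
    by unfold_locales (fact assms p_nonneg integrable | (rule p_nonneg; assumption) | (rule integrable; assumption))+
  have P_sets: "sets (P \<omega>) = sets W" and P_space: "space (P \<omega>) = space W" if "\<omega> \<in> space M" for \<omega>
    using measurable_space[OF P that] sets_eq_imp_space_eq[of "P \<omega>" W] by (auto simp: space_prob_algebra)
  \<comment> \<open>\<open>Y\<close>, \<open>T\<close> and \<open>X\<close> do not depend on the
    environment and every \<open>P \<omega>\<close> lives on \<open>W\<close>, so one environment is
    enough to read off measurability and the rule that determines \<open>X\<close>.\<close>
  obtain \<omega>0 where \<omega>0: "\<omega>0 \<in> space M" using not_empty by blast
  have [measurable]: "Y n \<in> measurable W (count_space UNIV)" "T n \<in> borel_measurable W" for n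
    using walk[OF \<omega>0] unfolding markov_jump_walk_def
    by (simp_all add: measurable_cong_sets[OF P_sets[OF \<omega>0] refl])
  define Z where "Z w n = (Y (Suc n) w - Y n w, 1 < T n w)" for w n
  have Z [measurable]: "Z \<in> measurable W path_space"
    unfolding path_space_def
  proof (rule measurable_PiM_single')
    fix n
    have "(\<lambda>w. (Y (Suc n) w, Y n w, 1 < T n w)) \<in> measurable W (count_space UNIV)"
      by (simp only: pair_measure_countable[symmetric] UNIV_Times_UNIV[symmetric] countableI_type) measurable
    from measurable_compose[OF this, of "\<lambda>(a, b, c). (a - b, c)" "count_space UNIV"]
    show "(\<lambda>w. Z w n) \<in> measurable W (count_space UNIV)" by (simp add: Z_def)
  qed auto
  define L where "L \<omega> = distr (P \<omega>) path_space Z" for \<omega>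
  interpret environment_walk M \<tau> p L
  proof
    show "L \<in> measurable M (prob_algebra path_space)"
      unfolding L_def[abs_def] using measurable_compose[OF P measurable_distr_prob_space[OF Z]] .
    fix \<omega> n and k :: "nat \<Rightarrow> int ^ 'd" and d assume \<omega>: "\<omega> \<in> space M"
    have "measure (L \<omega>) (cylinder n k d) = measure (P \<omega>) (Z -` cylinder n k d \<inter> space (P \<omega>))"
      unfolding L_def
      by (rule measure_distr) (simp_all add: measurable_cong_sets[OF P_sets[OF \<omega>] refl])
    also have "Z -` cylinder n k d \<inter> space (P \<omega>) =
        {w \<in> space (P \<omega>). \<forall>i<n. Y (Suc i) w - Y i w = k i \<and> (d i \<longrightarrow> 1 < T i w)}"
      by (auto simp: cylinder_def Z_def)
    also have "measure (P \<omega>) \<dots> = (\<Prod>i<n. jump_prob (environment_rates \<tau> p \<omega>) (\<Sum>j<i. k j) ((\<Sum>j<i. k j) + k i) *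
        exp (- (exit_rate (environment_rates \<tau> p \<omega>) (\<Sum>j<i. k j) * of_bool (d i))))"
      using jump_cylinder_law[OF walk[OF \<omega>]] by simp
    also have "\<dots> = (\<Prod>i<n. jump_kernel p (\<tau> (\<Sum>j<i. k j) \<omega>) (k i) *
        exp (- (total_rate p (\<tau> (\<Sum>j<i. k j) \<omega>) * of_bool (d i))))"
      by (simp only: jump_prob_environment exit_rate_environment)
    finally show "measure (L \<omega>) (cylinder n k d) = \<dots>" .
  qed
  have sym: "(\<integral>\<omega>. p (- k) \<omega> \<partial>M) = (\<integral>\<omega>. p k \<omega> \<partial>M)" if "k \<in> unit_steps" for k
    using divergence_form_integral_p[OF assms(7) assms(11) that] .
  obtain \<delta> where \<delta>: "0 < \<delta>" and
    long: "AE \<omega> in M. AE z in L \<omega>. \<exists>K. \<forall>n. \<delta> * real n - (\<Sum>j<n. of_bool (snd (z j))) \<le> K"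
    by (rule AE_long_holding_times_frequent)
  \<comment> \<open>Natural bounds \<open>K\<close> and slopes \<open>1 / real (Suc m)\<close>
    replace real ones, so that only countable quantifiers occur and the event is measurable.\<close>
  define good where "good z \<longleftrightarrow> (\<exists>K :: nat. \<forall>n. \<delta> * real n - (\<Sum>j<n. of_bool (snd (z j))) \<le> real K) \<and>
      (\<forall>i. \<forall>m. \<exists>K :: nat. \<forall>n. \<bar>\<Sum>j<n. real_of_int (fst (z j) $ i)\<bar> \<le> 1 / real (Suc m) * real n + real K)"
    for z :: "nat \<Rightarrow> (int ^ 'd) \<times> bool"
  have good_measurable [measurable]: "Measurable.pred path_space good"
    unfolding good_def by measurable
  have one_side: "AE \<omega> in M. AE z in L \<omega>.
        \<exists>K. \<forall>n. s * (\<Sum>j<n. real_of_int (fst (z j) $ i)) \<le> 1 / real (Suc m) * real n + K"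
    if "\<bar>s\<bar> = 1" for s i m
    by (rule AE_displacement_sublinear[OF sym that]) simp_all
  have X: "\<forall>w\<in>space (P \<omega>0). \<forall>n t. 0 \<le> t \<and> jump_time T n w \<le> ennreal t \<and> ennreal t < jump_time T (Suc n) w
      \<longrightarrow> X t w = Y n w"
    using walk[OF \<omega>0] unfolding markov_jump_walk_def by (elim conjE)
  have AE_good: "AE \<omega> in M. AE z in L \<omega>. good z"
  proof -
    have "AE \<omega> in M. \<forall>i m. AE z in L \<omega>.
          \<exists>K. \<forall>n. s * (\<Sum>j<n. real_of_int (fst (z j) $ i)) \<le> 1 / real (Suc m) * real n + K"
      if "\<bar>s\<bar> = 1" for s
      unfolding AE_all_countable using one_side[OF that] by blast
    from this[of 1, simplified abs_one, OF refl] this[of "- 1", simplified abs_neg_one, OF refl]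
      long show ?thesis
    proof eventually_elim
      case (elim \<omega>)
      then have "AE z in L \<omega>. \<forall>i m. \<exists>K. \<forall>n. 1 * (\<Sum>j<n. real_of_int (fst (z j) $ i)) \<le> 1 / real (Suc m) * real n + K"
        "AE z in L \<omega>. \<forall>i m. \<exists>K. \<forall>n. (- 1) * (\<Sum>j<n. real_of_int (fst (z j) $ i)) \<le> 1 / real (Suc m) * real n + K"
        unfolding AE_all_countable by blast+
      then show ?case using elim(3)
      proof eventually_elim
        case (elim z)
        have "\<exists>K :: nat. \<forall>n. \<bar>\<Sum>j<n. real_of_int (fst (z j) $ i)\<bar> \<le> 1 / real (Suc m) * real n + real K" for i m
        proof -
          obtain K1 K2 where K: "\<And>n. 1 * (\<Sum>j<n. real_of_int (fst (z j) $ i)) \<le> 1 / real (Suc m) * real n + K1"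
            "\<And>n. (- 1) * (\<Sum>j<n. real_of_int (fst (z j) $ i)) \<le> 1 / real (Suc m) * real n + K2"
            using elim(1,2) by metis
          obtain N :: nat where N: "max K1 K2 \<le> real N" using real_arch_simple by blast
          have "\<bar>\<Sum>j<n. real_of_int (fst (z j) $ i)\<bar> \<le> 1 / real (Suc m) * real n + real N" for n
            using K(1)[of n] K(2)[of n] N by linarith
          then show ?thesis by blast
        qed
        moreover obtain K where "\<And>n. \<delta> * real n - (\<Sum>j<n. of_bool (snd (z j))) \<le> K" using elim(3) by blast
        moreover obtain N :: nat where "K \<le> real N" using real_arch_simple by blast
        ultimately show ?case unfolding good_def by (meson order_trans)
      qed
    qed
  qed
  \<comment> \<open>Disintegrating the annealed law requires a measurable event, while no
    measurability of \<open>X\<close> is assumed. Hence only jumps and flags are transferred, and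
    the limit is then derived path by path.\<close>
  have "AE w in annealed M P. good (Z w) \<and> Y 0 w = 0"
  proof (subst AE_bind[OF measurable_prob_algebraD[OF P]])
    show "AE \<omega> in M. AE w in P \<omega>. good (Z w) \<and> Y 0 w = 0"
      using AE_good AE_space
    proof eventually_elim
      case (elim \<omega>)
      have "AE w in P \<omega>. good (Z w)"
        using elim(1) unfolding L_def
        by (rule AE_distrD[rotated]) (simp add: measurable_cong_sets[OF P_sets[OF elim(2)] refl])
      then show ?case using AE_initial_position[OF walk[OF elim(2)]] by eventually_elim simp
    qed
  qed measurable
  moreover have "space (annealed M P) = space W"
    using P_sets not_empty by (rule space_bind)
  then have "AE w in annealed M P. w \<in> space W" using AE_space[of "annealed M P"] by simp
  ultimately show ?thesis
  proof eventually_elim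
    case (elim w)
    then have good: "good (Z w)" and Y0: "Y 0 w = 0" and w: "w \<in> space (P \<omega>0)" using P_space[OF \<omega>0] by auto
    obtain K :: nat where K: "\<And>n. \<delta> * real n - (\<Sum>j<n. of_bool (1 < T j w)) \<le> real K"
      using good by (auto simp: good_def Z_def)
    have displacement: "real_of_int (Y n w $ i) = (\<Sum>j<n. real_of_int (fst (Z w j) $ i))" for n i
      by (induction n) (simp_all add: Y0 Z_def)
    show ?case
    proof (rule jump_walk_speed_zero[OF _ \<delta>, where J="\<lambda>n. jump_time T n w" and y="\<lambda>n. Y n w" and K=K])
      show "jump_time T 0 w = 0" by (simp add: jump_time_def)
      fix n
      \<comment> \<open>Each flagged holding time contributes at least 1 to the jump time, so the
        number of flags is a lower bound.\<close>
      have "ennreal (\<delta> * real n - K) \<le> ennreal (\<Sum>j<n. of_bool (1 < T j w))"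
        using K[of n] by (intro ennreal_leI) simp
      also have "\<dots> = (\<Sum>j<n. of_bool (1 < T j w))"
        by (simp add: ennreal_of_nat_eq_real_of_nat)
      also have "\<dots> \<le> jump_time T n w" unfolding jump_time_def by (rule sum_mono) auto
      finally show "ennreal (\<delta> * real n - K) \<le> jump_time T n w" .
    next
      show "X t w = Y n w" if "0 \<le> t" "jump_time T n w \<le> ennreal t" "ennreal t < jump_time T (Suc n) w" for n t
        using X w that by blast
    next
      fix i and \<epsilon> :: real assume \<epsilon>: "0 < \<epsilon>"
      obtain m where m: "1 / real (Suc m) < \<epsilon>" using \<epsilon> by (meson nat_approx_posE)
      obtain C :: nat where C: "\<And>n. \<bar>real_of_int (Y n w $ i)\<bar> \<le> 1 / real (Suc m) * real n + real C"
        using conjunct2[OF good[unfolded good_def], rule_format, of i m]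
        unfolding displacement[symmetric] by blast
      have "\<bar>real_of_int (Y n w $ i)\<bar> \<le> \<epsilon> * real n + real C" for n
        using C[of n] mult_right_mono[of "1 / real (Suc m)" \<epsilon> "real n"] m by linarith
      then show "\<exists>C. \<forall>n. \<bar>real_of_int (Y n w $ i)\<bar> \<le> \<epsilon> * real n + C" by blast
    qed
  qed
qed

end
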